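(* For $|X|<1$, \begin{align*} &\sum_{k=1}^{\infty}\Big(\pi\zeta(2k)-2i\sum_{u=1}^{k-1}\frac{(-1)^{u}(1-2^{2u})B_{2u}\pi^{2u}}{(2u)!}\zeta(\{1\}^{2(k-u)-1},2)\\ &\qquad-i\sum_{u=0}^{k-2}\frac{(-1)^{u}(2-2^{2u})B_{2u}\pi^{2u}}{(2u)!}\sum_{v=1}^{k-u-1}\zeta(\{1\}^{2(k-v-u)-1},2v+2)\Big)X^{2k}\\ &=\frac{\pi}{2}-\frac{\pi^{2}}{2}X\cot(\pi X)+i\pi X^{2}\csc(\pi X)\int_{0}^{\frac{\pi}{3}}\sin((\theta+\pi)X)A(\theta)\,d\theta\\ &\qquad-2i\pi X\csc(\pi X)\int_{0}^{\frac{\pi}{3}}\sinh(A(\theta)X)\sin\left(\frac{\theta+\pi}{2}X\right)\cos((\theta-\pi)X)\,d\theta, \end{align*} where $A(\theta)=\log|2\sin(\theta/2)|$. In particular, for every $k\in\mathbb{N}$, \[\zeta(2k)=(-1)^{k+1}\frac{(2\pi)^{2k}B_{2k}}{2(2k)!}.\]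
   Context: For positive integers $k_1,\dots,k_n$ with $k_n\ge2$, the multiple zeta value is $\zeta(k_1,\dots,k_n)=\sum_{0<m_1<\dots<m_n}\frac{1}{m_1^{k_1}\cdots m_n^{k_n}}$; $\{1\}^m$ denotes $m$ repetitions of $1$. $B_k$ denote the Bernoulli numbers (with $B_0=1$). *)

theory Defs
  imports "HOL-Analysis.Analysis"
begin

text \<open>Bernoulli numbers via the standard recurrence
  B_0 = 1, sum_{j=0}^{n} binom(n+1,j) B_j = 0 for n >= 1 (so B_1 = -1/2).\<close>
function bernoulli :: "nat \<Rightarrow> real" where
  "bernoulli n = (if n = 0 then 1
     else - (\<Sum>j<n. real (Suc n choose j) * bernoulli j) / real (Suc n))"
  by auto
termination by (relation "Wellfounded.measure id") auto

definition mzv :: "nat list \<Rightarrow> real" where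
  "mzv ks = infsum (\<lambda>ms. \<Prod>i<length ks. 1 / real (ms ! i) ^ (ks ! i))
     {ms. length ms = length ks \<and> sorted_wrt (<) ms \<and> 0 \<notin> set ms}"

definition A_fun :: "real \<Rightarrow> real" where
  "A_fun \<theta> = ln \<bar>2 * sin (\<theta> / 2)\<bar>"

definition coeff4p2 :: "nat \<Rightarrow> complex" where
  "coeff4p2 k =
     of_real (pi * mzv [2 * k])
     - 2 * \<i> * (\<Sum>u=1..k-1. of_real ((-1) ^ u * (1 - 2 ^ (2*u)) * bernoulli (2*u) * pi ^ (2*u)
                                     / fact (2*u) * mzv (replicate (2*(k-u) - 1) 1 @ [2])))
     - \<i> * (\<Sum>u<k-1. of_real ((-1) ^ u * (2 - 2 ^ (2*u)) * bernoulli (2*u) * pi ^ (2*u) / fact (2*u)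
                 * (\<Sum>v=1..k-u-1. mzv (replicate (2*(k - v - u) - 1) 1 @ [(2 * v + 2)]))))"

end

(* Write A = A_fun.  For |x|, |y| < 1 the generating function of the values zeta({1}^m, n+2),
   with weights x^(m+1) y^n, is P(x,y) = sum over N >= 1 of (x)_N / (N! (N - y)), since the sum over m
   of x^(m+1) e_m(1, 1/2, ..., 1/(N-1)) is (x)_N / (N-1)!.  This is the value at t = 1 of the primitive
   t^(-y) * sum of (x)_N t^N / (N! (N - y)) of t^(-y-1) ((1-t)^(-x) - 1), continuous on the closed unit disc.
   Instead of the segment from 0 to 1 one follows the arc 1 - exp(-i theta) up to exp(i pi / 3), and then the
   arc exp(i theta) back to 1.  On these arcs one of t and 1 - t has modulus one and the logarithm of the
   other one is A(theta) plus or minus i (theta - pi) / 2, so P(x,y) becomes an integral over [0, pi/3].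
   The reflected path gives the same formula with i replaced by -i.

   The series in the theorem is a Cauchy product of the expansions of tan and csc, whose coefficients are
   given by the even zeta values, with parity components of P: these are
   W(X) = (P(X,0) + P(-X,0)) / 2 and the mean K(X) of P over the four sign choices (+-X, +-X).
   The two terms P(X,-X) and P(-X,X) cancel, and the integral formulas for the others combine to
   K(X) - cos(pi X) W(X). *)
theory Submission
  imports Defs "HOL-Complex_Analysis.Complex_Analysis"
begin

subsection \<open>Binomial coefficient series\<close>

text \<open>Both ends of the path are delicate. On the unit circle the differentiated series need
  not converge, and at \<open>t = 0\<close> the power \<open>t powr (- y)\<close> has its branch
  point. The fundamental theorem of calculus asks only for continuity at the endpoints, so it yields
  the value of each integral together with its existence, although the integrand may be singular at
  theta = 0. On the arc leaving 0 the form dt / t would bring in the derivative of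
  \<open>A_fun\<close>; integration by parts avoids this but divides by y, so y = 0 needs its own
  argument with a logarithm. The reflected path is never integrated: the coefficients of P are real,
  so complex conjugation supplies its formula. Having two formulas for one value is what disposes of
  the boundary terms, which cancel when a direct formula is paired with a reflected one at the
  opposite argument. Over the common denominator sin(pi X) the Cauchy products combine by (1 - cos)
  W + (K - W) = K - cos W. The formula for zeta(2k) does not come from the integrals: it rests on
  the reflection formula of the digamma function.\<close>

definition binc :: "'a::field_char_0 \<Rightarrow> nat \<Rightarrow> 'a"
  where "binc x n = pochhammer x n / fact n"

lemma binc_0 [simp]: "binc x 0 = 1"
  by (simp add: binc_def)

lemma binc_Suc: "binc x (Suc n) = binc x n * (x + of_nat n) / of_nat (Suc n)"
  by (simp add: binc_def pochhammer_Suc divide_simps)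

text \<open>\<open>binc x n\<close> is a polynomial in \<open>x\<close> with nonnegative
  coefficients. The real instance at \<open>norm x\<close> therefore majorises the complex one,
  which is why \<open>binc\<close> is polymorphic.\<close>

lemma norm_binc_le: "norm (binc (x::complex) n) \<le> binc (norm x) n"
proof (induction n)
  case (Suc n)
  have "norm (x + of_nat n) \<le> norm x + of_nat n"
    using norm_triangle_ineq[of x "of_nat n"] by simp
  hence "norm (binc x n) * norm (x + of_nat n) \<le> binc (norm x) n * (norm x + of_nat n)"
    using Suc by (intro mult_mono) (auto simp: order_trans[OF norm_ge_zero])
  thus ?case
    by (simp add: binc_Suc norm_mult norm_divide divide_right_mono del: of_nat_Suc)
qed auto

lemma binc_nonneg: "0 \<le> (a::real) \<Longrightarrow> 0 \<le> binc a n"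
  by (induction n) (auto simp: binc_Suc)

text \<open>The terms telescope: \<open>binc a n - binc a (n + 1) = (1 - a) * binc a n / (n + 1)\<close>.\<close>
lemma summable_binc_div:
  assumes "0 \<le> (a::real)" "a < 1"
  shows "summable (\<lambda>n. binc a n / of_nat n)"
proof -
  have eq: "binc a n / of_nat (Suc n) = (binc a n - binc a (Suc n)) / (1 - a)" for n
  proof -
    have "binc a (Suc n) = binc a n - (1 - a) * (binc a n / of_nat (Suc n))"
      by (simp add: binc_Suc field_simps)
    thus ?thesis using assms by simp
  qed
  have dec: "binc a (Suc n) \<le> binc a n" for n
    using binc_nonneg[OF assms(1), of n] assms(2)
    by (simp add: binc_Suc divide_le_eq mult_left_mono)
  have "convergent (binc a)"
    using binc_nonneg[OF assms(1)] dec
    by (intro Bseq_monoseq_convergent decseq_bounded[where B=0] decseq_SucI decseq_imp_monoseq) auto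
  then obtain L where "binc a \<longlonglongrightarrow> L" by (auto simp: convergent_def)
  hence "(\<lambda>n. binc a n - binc a (Suc n)) sums (binc a 0 - L)"
    by (rule telescope_sums')
  hence "summable (\<lambda>n. binc a n / of_nat (Suc n))"
    unfolding eq by (intro summable_divide) (auto simp: sums_iff)
  \<comment> \<open>The factor 2 pays for replacing n + 1 by n in the denominator, since n + 1 \<le>
    2 n for n \<ge> 1. At n = 0 division by zero makes the term 0.\<close>
  hence "summable (\<lambda>n. 2 * (binc a n / of_nat (Suc n)))"
    by (rule summable_mult)
  thus ?thesis
  proof (rule summable_comparison_test')
    fix n :: nat assume "n \<ge> 0"
    show "norm (binc a n / of_nat n) \<le> 2 * (binc a n / of_nat (Suc n))"
    proof (cases "n = 0")
      case False
      have "binc a n * (1 + real n) \<le> binc a n * (2 * real n)"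
        using False binc_nonneg[OF assms(1)] by (intro mult_left_mono) auto
      thus ?thesis using False binc_nonneg[OF assms(1), of n]
        by (simp add: field_simps)
    qed (auto simp: binc_nonneg assms)
  qed
qed

lemma binc_sums:
  fixes x t :: complex
  assumes "norm t < 1"
  shows "(\<lambda>n. binc x n * t ^ n) sums ((1 - t) powr (- x))"
proof -
  have "((-x) gchoose n) * (-t) ^ n = binc x n * t ^ n" for n
    using power_mult_distrib[of "-1" "-t" n] by (simp add: gbinomial_pochhammer binc_def)
  thus ?thesis using gen_binomial_complex[of "-t" "-x"] assms by simp
qed

text \<open>Termwise integration of t^(n - y - 1) divides by n - y. The coefficient at n = 0 is 0
  because \<open>integrand\<close> subtracts the constant term of (1 - t)^(-x).\<close>

definition hcoef :: "complex \<Rightarrow> complex \<Rightarrow> nat \<Rightarrow> complex"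
  where "hcoef x y n = (if n = 0 then 0 else binc x n / (of_nat n - y))"

definition hser :: "complex \<Rightarrow> complex \<Rightarrow> complex \<Rightarrow> complex"
  where "hser x y t = (\<Sum>n. hcoef x y n * t ^ n)"

lemma of_nat_minus_nz: "norm (y::complex) < 1 \<Longrightarrow> n \<noteq> 0 \<Longrightarrow> of_nat n - y \<noteq> 0"
  by (metis eq_iff_diff_eq_0 less_one norm_of_nat of_nat_less_1_iff)

text \<open>For n \<ge> 1 one has |n - y| \<ge> n - |y| \<ge> n (1 - |y|).\<close>

lemma norm_hcoef_le:
  assumes "norm y < 1"
  shows "norm (hcoef x y n) \<le> binc (norm x) n / of_nat n / (1 - norm y)"
proof (cases "n = 0")
  case False
  have "of_nat n * (1 - norm y) \<le> of_nat n - norm y"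
    using False mult_right_mono[of 1 "real n" "norm y"] by (simp add: algebra_simps)
  also have "\<dots> \<le> norm (of_nat n - y)"
    using norm_triangle_ineq2[of "of_nat n" y] by simp
  finally have "norm (binc x n) / norm (of_nat n - y) \<le> binc (norm x) n / (of_nat n * (1 - norm y))"
    using False assms by (intro frac_le norm_binc_le) (auto simp: binc_nonneg)
  thus ?thesis using False by (simp add: hcoef_def norm_divide)
qed (simp add: hcoef_def)

lemma summable_hcoef_bound:
  assumes "norm (x::complex) < 1"
  shows "summable (\<lambda>n. binc (norm x) n / of_nat n / (1 - c))"
  using assms by (intro summable_divide summable_binc_div) auto

text \<open>The coefficients themselves are absolutely summable, so the convergence is uniform up to
  the unit circle. Continuity there is what gives access to the value at
  \<open>t = 1\<close>.\<close>

lemma continuous_on_hser: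
  assumes "norm x < 1" "norm y < 1"
  shows "continuous_on (cball 0 1) (hser x y)"
proof -
  have "uniform_limit (cball 0 1) (\<lambda>n t. \<Sum>i<n. hcoef x y i * t ^ i) (hser x y) sequentially"
    unfolding hser_def
  proof (rule Weierstrass_m_test)
    fix n and t :: complex assume t: "t \<in> cball 0 1"
    have "norm (hcoef x y n * t ^ n) \<le> norm (hcoef x y n) * 1"
      unfolding norm_mult norm_power using t by (intro mult_left_mono) (auto intro: power_le_one)
    also have "\<dots> \<le> binc (norm x) n / of_nat n / (1 - norm y)"
      using norm_hcoef_le[OF assms(2)] by simp
    finally show "norm (hcoef x y n * t ^ n) \<le> binc (norm x) n / of_nat n / (1 - norm y)" .
  qed (rule summable_hcoef_bound[OF assms(1)])
  thus ?thesis
    by (rule uniform_limit_theorem[rotated]) (auto intro!: always_eventually continuous_intros)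
qed

lemma summable_hcoef:
  assumes "norm x < 1" "norm y < 1"
  shows "summable (\<lambda>n. norm (hcoef x y n))"
  by (rule summable_comparison_test'[OF summable_hcoef_bound[OF assms(1), of "norm y"], of 0])
     (simp add: norm_hcoef_le[OF assms(2)] del: divide_divide_eq_left)

text \<open>The operator t d/dt - y multiplies the coefficient at n by n - y and cancels the
  denominator of \<open>hcoef\<close>, leaving the binomial series without its constant
  term.\<close>

lemma hser_deriv:
  assumes "norm x < 1" "norm y < 1" "norm t < 1"
  obtains h' where "(hser x y has_field_derivative h') (at t)" "t * h' - y * hser x y t = (1 - t) powr (- x) - 1"
proof
  define h' where "h' = (\<Sum>n. diffs (hcoef x y) n * t ^ n)"
  have s: "summable (\<lambda>n. hcoef x y n * z ^ n)" if "norm z < 1" for z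
  proof (rule summable_comparison_test'[OF summable_hcoef[OF assms(1,2)]])
    fix n
    show "norm (hcoef x y n * z ^ n) \<le> norm (hcoef x y n)"
      using that unfolding norm_mult norm_power by (intro mult_right_le_one_le power_le_one) auto
  qed
  show "(hser x y has_field_derivative h') (at t)"
    unfolding hser_def[abs_def] h'_def using s assms(3) by (rule termdiffs_strong')
  have "summable (\<lambda>n. diffs (hcoef x y) n * t ^ n)"
    using termdiff_converges[OF assms(3)] s by blast
  hence "(\<lambda>n. diffs (hcoef x y) n * t ^ n) sums h'"
    by (simp add: h'_def summable_sums)
  hence "(\<lambda>n. t * (diffs (hcoef x y) n * t ^ n)) sums (t * h')"
    by (rule sums_mult)
  hence "(\<lambda>n. of_nat (Suc n) * hcoef x y (Suc n) * t ^ Suc n) sums (t * h')"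
    by (simp add: diffs_def mult_ac)
  hence "(\<lambda>n. of_nat n * hcoef x y n * t ^ n) sums (t * h')"
    using sums_Suc[of "\<lambda>n. of_nat n * hcoef x y n * t ^ n"] by simp
  moreover have "(\<lambda>n. y * (hcoef x y n * t ^ n)) sums (y * hser x y t)"
    unfolding hser_def by (intro sums_mult summable_sums s assms)
  ultimately have "(\<lambda>n. of_nat n * hcoef x y n * t ^ n - y * (hcoef x y n * t ^ n)) sums (t * h' - y * hser x y t)"
    by (rule sums_diff)
  moreover have "of_nat n * hcoef x y n * t ^ n - y * (hcoef x y n * t ^ n) = binc x n * t ^ n - (if n = 0 then 1 else 0)" for n
  proof -
    have "of_nat n * hcoef x y n * t ^ n - y * (hcoef x y n * t ^ n) = (of_nat n - y) * hcoef x y n * t ^ n"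
      by (simp add: algebra_simps)
    thus ?thesis using of_nat_minus_nz[OF assms(2), of n] by (simp add: hcoef_def)
  qed
  ultimately have "(\<lambda>n. binc x n * t ^ n - (if n = 0 then 1 else 0)) sums (t * h' - y * hser x y t)"
    by simp
  moreover have "(\<lambda>n. binc x n * t ^ n - (if n = 0 then 1 else 0)) sums ((1 - t) powr (- x) - 1)"
    using sums_single[of 0 "\<lambda>_. 1::complex"] by (intro sums_diff binc_sums assms) simp
  ultimately show "t * h' - y * hser x y t = (1 - t) powr (- x) - 1"
    by (rule sums_unique2)
qed

subsection \<open>The incomplete beta integral\<close>

definition Pfun :: "complex \<Rightarrow> complex \<Rightarrow> complex \<Rightarrow> complex"
  where "Pfun x y t = t powr (- y) * hser x y t"

definition integrand :: "complex \<Rightarrow> complex \<Rightarrow> complex \<Rightarrow> complex"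
  where "integrand x y t = t powr (- y - 1) * ((1 - t) powr (- x) - 1)"

text \<open>The upper half-plane is a convex domain on which both powers in \<open>integrand\<close>
  are holomorphic, and both arcs lie in it except for their endpoints 0 and 1.\<close>

lemma Im_pos_notin_nonpos_Reals: "0 < Im t \<Longrightarrow> t \<notin> \<real>\<^sub>\<le>\<^sub>0 \<and> 1 - t \<notin> \<real>\<^sub>\<le>\<^sub>0"
  by (auto simp: complex_nonpos_Reals_iff)

lemma Pfun_deriv:
  assumes "norm x < 1" "norm y < 1" "norm t < 1" "0 < Im t"
  shows "(Pfun x y has_field_derivative integrand x y t) (at t)"
proof -
  obtain h' where h': "(hser x y has_field_derivative h') (at t)"
    "t * h' - y * hser x y t = (1 - t) powr (- x) - 1"
    using hser_deriv assms by blast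
  have t: "t \<notin> \<real>\<^sub>\<le>\<^sub>0" "t \<noteq> 0" using assms Im_pos_notin_nonpos_Reals[of t] by auto
  have "(Pfun x y has_field_derivative
         (- y * t powr (- y - 1)) * hser x y t + t powr (- y) * h') (at t)"
    unfolding Pfun_def[abs_def] using t by (auto intro!: derivative_eq_intros h'(1))
  also have "t powr (- y) = t powr (- y - 1) * t"
    using t by (simp add: powr_diff)
  also have "(- y * t powr (- y - 1)) * hser x y t + t powr (- y - 1) * t * h' = integrand x y t"
    unfolding integrand_def h'(2)[symmetric] by (simp add: algebra_simps)
  finally show ?thesis .
qed

text \<open>The series of \<open>Pfun\<close> cannot be differentiated termwise on the unit circle; a primitive that is holomorphic across the circle agrees with \<open>Pfun\<close> there by radial limits.\<close>
lemma Pfun_primitive: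
  assumes "norm x < 1" "norm y < 1"
  obtains g where "\<And>t. 0 < Im t \<Longrightarrow> (g has_field_derivative integrand x y t) (at t)"
    and "\<And>t. 0 < Im t \<Longrightarrow> norm t \<le> 1 \<Longrightarrow> Pfun x y t = g t"
proof -
  have op: "open {t. 0 < Im t}" by (rule open_halfspace_Im_gt)
  have "integrand x y holomorphic_on {t. 0 < Im t}"
    unfolding integrand_def using Im_pos_notin_nonpos_Reals
    by (auto intro!: holomorphic_intros)
  then obtain g where g: "\<And>t. 0 < Im t \<Longrightarrow> (g has_field_derivative integrand x y t) (at t within {t. 0 < Im t})"
    using holomorphic_convex_primitive'[OF convex_halfspace_Im_gt op] by (metis mem_Collect_eq)
  have g: "(g has_field_derivative integrand x y t) (at t)" if "0 < Im t" for t
    using g[OF that] at_within_open[OF _ op, of t] that by simp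
  define D where "D t = Pfun x y t - g t" for t
  have "\<exists>c. \<forall>t \<in> {t. 0 < Im t} \<inter> ball 0 1. D t = c"
  proof (rule has_field_derivative_zero_constant)
    show "convex ({t. 0 < Im t} \<inter> ball 0 1)"
      by (intro convex_Int convex_halfspace_Im_gt convex_ball)
    fix t assume "t \<in> {t. 0 < Im t} \<inter> ball 0 1"
    thus "(D has_field_derivative 0) (at t within {t. 0 < Im t} \<inter> ball 0 1)"
      unfolding D_def[abs_def] using DERIV_diff[OF Pfun_deriv[OF assms, of t] g[of t]]
      by (auto intro: has_field_derivative_at_within)
  qed
  then obtain c where c: "\<And>t. 0 < Im t \<Longrightarrow> norm t < 1 \<Longrightarrow> D t = c" by auto
  have "Pfun x y t = g t + c" if t: "0 < Im t" "norm t \<le> 1" for t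
  proof -
    \<comment> \<open>The radial segment from t/2 to t: a positive lower end keeps
      \<open>of_real r * t\<close> in the open half-plane, and r < 1 puts it inside the
      disc.\<close>
    define S where "S = {1/2..<1::real}"
    have cl: "closure S = {1/2..1}" by (simp add: S_def)
    have "continuous_on (closure S) (\<lambda>r. D (of_real r * t))"
      unfolding cl
    proof (rule continuous_on_compose2[where g = D])
      show "continuous_on ({t. 0 < Im t} \<inter> cball 0 1) D"
        unfolding D_def Pfun_def
      proof (intro continuous_intros)
        show "continuous_on ({t. 0 < Im t} \<inter> cball 0 1) (hser x y)"
          using continuous_on_hser[OF assms] by (rule continuous_on_subset) auto
        show "continuous_on ({t. 0 < Im t} \<inter> cball 0 1) g"
          using g by (intro continuous_at_imp_continuous_on) (auto intro: DERIV_isCont)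
      qed (use Im_pos_notin_nonpos_Reals in auto)
      show "(\<lambda>r. of_real r * t) ` {1/2..1} \<subseteq> {t. 0 < Im t} \<inter> cball 0 1"
        using t by (auto simp: norm_mult intro!: mult_le_one)
    qed (intro continuous_intros)
    moreover have "D (of_real r * t) = c" if "r \<in> S" for r
    proof (rule c)
      have "\<bar>r\<bar> * norm t \<le> \<bar>r\<bar> * 1"
        using t by (intro mult_left_mono) auto
      moreover have "0 \<le> r" "r < 1" using that by (auto simp: S_def)
      ultimately show "norm (of_real r * t) < 1" by (simp add: norm_mult)
    qed (use that t in \<open>auto simp: S_def\<close>)
    ultimately have "D (of_real 1 * t) = c"
      by (rule continuous_constant_on_closure) (auto simp: cl)
    thus ?thesis by (simp add: D_def algebra_simps)
  qed
  moreover have "((\<lambda>t. g t + c) has_field_derivative integrand x y t) (at t)" if "0 < Im t" for t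
    using g[OF that] by (auto intro!: derivative_eq_intros)
  ultimately show ?thesis using that[of "\<lambda>t. g t + c"] by blast
qed

text \<open>The derivative is that of the holomorphic primitive, which is known to equal
  \<open>Pfun\<close> only in the closed disc. The condition on \<open>\<gamma>\<close> covers the
  whole open interval because both functions must agree along the curve near
  \<open>s\<close>.\<close>

lemma Pfun_curve_deriv:
  assumes xy: "norm x < 1" "norm y < 1"
    and \<gamma>: "\<And>s. s \<in> {a<..<b} \<Longrightarrow> 0 < Im (\<gamma> s) \<and> norm (\<gamma> s) \<le> 1"
    and s: "s \<in> {a<..<b}" and d: "(\<gamma> has_vector_derivative \<gamma>') (at s)"
  shows "((\<lambda>s. Pfun x y (\<gamma> s)) has_vector_derivative integrand x y (\<gamma> s) * \<gamma>') (at s)"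
proof -
  obtain g where g: "\<And>t. 0 < Im t \<Longrightarrow> (g has_field_derivative integrand x y t) (at t)"
    and eq: "\<And>t. 0 < Im t \<Longrightarrow> norm t \<le> 1 \<Longrightarrow> Pfun x y t = g t"
    using Pfun_primitive[OF xy] by blast
  have "((g \<circ> \<gamma>) has_vector_derivative integrand x y (\<gamma> s) * \<gamma>') (at s)"
    using field_vector_diff_chain_at[OF d g] \<gamma>[OF s] by (simp add: mult.commute)
  thus ?thesis
    by (rule has_vector_derivative_transform_within_open[OF _ _ s]) (use \<gamma> eq in auto)
qed

section \<open>Logarithms of 1 - exp(i theta) and its conjugate\<close>

lemma exp_A_fun: "0 < \<theta> \<Longrightarrow> \<theta> < 2 * pi \<Longrightarrow> exp (A_fun \<theta>) = 2 * sin (\<theta> / 2)"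
  using sin_gt_zero[of "\<theta> / 2"] by (simp add: A_fun_def)

text \<open>Factoring out exp(i theta / 2) leaves -2 i sin(theta / 2), and -i shifts the argument by
  -pi/2. The resulting argument lies strictly between -pi/2 and pi/2, so the principal
  \<open>Ln\<close> returns this exponent unchanged.\<close>

lemma one_minus_cis_eq:
  assumes "0 < \<theta>" "\<theta> < 2 * pi"
  shows "1 - exp (\<i> * of_real \<theta>) = exp (of_real (A_fun \<theta>) + \<i> * of_real ((\<theta> - pi) / 2))"
proof -
  have e: "cos ((\<theta> - pi) / 2) = sin (\<theta> / 2)" "sin ((\<theta> - pi) / 2) = - cos (\<theta> / 2)"
    by (simp_all add: diff_divide_distrib cos_diff sin_diff)
  have "sin \<theta> = 2 * sin (\<theta> / 2) * cos (\<theta> / 2)" "cos \<theta> = 1 - 2 * sin (\<theta> / 2) ^ 2"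
    using sin_double[of "\<theta> / 2"] cos_double_sin[of "\<theta> / 2"] by auto
  thus ?thesis
    by (simp add: complex_eq_iff exp_add Re_exp Im_exp exp_A_fun[OF assms] e power2_eq_square)
qed

lemma Ln_one_minus_cis:
  assumes "0 < \<theta>" "\<theta> < 2 * pi"
  shows "Ln (1 - exp (\<i> * of_real \<theta>)) = of_real (A_fun \<theta>) + \<i> * of_real ((\<theta> - pi) / 2)"
  unfolding one_minus_cis_eq[OF assms] using assms by (intro Ln_exp) auto

lemma Ln_one_minus_cis':
  assumes "0 < \<theta>" "\<theta> < 2 * pi"
  shows "Ln (1 - exp (- \<i> * of_real \<theta>)) = of_real (A_fun \<theta>) + \<i> * of_real ((pi - \<theta>) / 2)"
proof -
  have "1 - exp (- \<i> * of_real \<theta>) = cnj (1 - exp (\<i> * of_real \<theta>))"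
    by (simp add: exp_cnj)
  also have "\<dots> = exp (of_real (A_fun \<theta>) + \<i> * of_real ((pi - \<theta>) / 2))"
    unfolding one_minus_cis_eq[OF assms] exp_cnj
    by (rule arg_cong[where f=exp]) (simp add: complex_eq_iff field_simps)
  finally show ?thesis using assms by simp
qed

subsection \<open>Two circular arcs\<close>

text \<open>In the upper half-plane the circles |t| = 1 and |1 - t| = 1 meet only at this point,
  which is the origin of the limit pi/3 in the integrals.\<close>

definition rho :: complex where "rho = exp (\<i> * of_real (pi / 3))"

lemma rho_eq: "1 - exp (- (\<i> * of_real (pi / 3))) = rho"
proof -
  have "exp (- (\<i> * of_real (pi / 3))) = cis (- (pi / 3))" "rho = cis (pi / 3)"
    by (simp_all add: cis_conv_exp rho_def)
  thus ?thesis by (simp add: complex_eq_iff cos_60 sin_60)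
qed

lemma powr_exp_i:
  assumes "\<theta> \<in> {0..pi/3}"
  shows "exp (\<i> * of_real \<theta>) powr z = exp (z * (\<i> * of_real \<theta>))"
    "exp (- \<i> * of_real \<theta>) powr z = exp (z * (- \<i> * of_real \<theta>))"
proof -
  have "Ln (exp (\<i> * of_real \<theta>)) = \<i> * of_real \<theta>" "Ln (exp (- \<i> * of_real \<theta>)) = - \<i> * of_real \<theta>"
    using assms pi_gt_zero by (auto intro!: Ln_exp simp del: pi_gt_zero)
  thus "exp (\<i> * of_real \<theta>) powr z = exp (z * (\<i> * of_real \<theta>))"
    "exp (- \<i> * of_real \<theta>) powr z = exp (z * (- \<i> * of_real \<theta>))"
    by (simp_all add: powr_def)
qed

text \<open>On this arc dt / t = i dtheta, so the constant -1 in \<open>integrand\<close>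
  contributes - i exp(- i y theta), which the derivative of \<open>E\<close> cancels.
  \<open>E\<close> is a parameter because its form differs for y = 0 and y \<noteq> 0.\<close>

lemma arc_unit_integral:
  assumes xy: "norm x < 1" "norm y < 1"
    and E: "\<And>z. (E has_field_derivative \<i> * exp (- \<i> * y * z)) (at z)"
  shows "((\<lambda>\<theta>. \<i> * exp (- \<i> * y * of_real \<theta> - x * (of_real (A_fun \<theta>) + \<i> * of_real ((\<theta> - pi) / 2))))
          has_integral (Pfun x y rho + E (of_real (pi / 3))) - (Pfun x y 1 + E 0)) {0..pi/3}"
proof -
  let ?g = "\<lambda>\<theta>::real. exp (\<i> * of_real \<theta>)"
  let ?V = "\<lambda>\<theta>::real. Pfun x y (?g \<theta>) + E (of_real \<theta>)"
  have cos_pos: "cos \<theta> > 0" if "\<theta> \<in> {0..pi/3}" for \<theta>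
    using that pi_gt_zero by (intro cos_gt_zero_pi) (auto simp del: pi_gt_zero)
  have "((\<lambda>\<theta>. \<i> * exp (- \<i> * y * of_real \<theta> - x * (of_real (A_fun \<theta>) + \<i> * of_real ((\<theta> - pi) / 2))))
          has_integral (?V (pi / 3) - ?V 0)) {0..pi/3}"
  proof (rule fundamental_theorem_of_calculus_interior)
    have "continuous_on {0..pi/3} (\<lambda>\<theta>. hser x y (?g \<theta>))"
      by (rule continuous_on_compose2[OF continuous_on_hser[OF xy]]) (auto intro!: continuous_intros simp: norm_exp_eq_Re)
    moreover have "continuous_on {0..pi/3} (\<lambda>\<theta>. E (of_real \<theta>))"
      by (rule continuous_on_compose2[of UNIV E])
         (auto intro!: continuous_at_imp_continuous_on DERIV_isCont[OF E])
    ultimately show "continuous_on {0..pi/3} ?V"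
      unfolding Pfun_def by (intro continuous_intros) (use cos_pos in \<open>auto simp: complex_nonpos_Reals_iff Re_exp\<close>, fastforce)
  next
    fix \<theta> assume th: "\<theta> \<in> {0<..<pi/3}"
    have "(?g has_vector_derivative (\<i> * ?g \<theta>)) (at \<theta>)"
      by (rule has_vector_derivative_real_field) (auto intro!: derivative_eq_intros)
    hence "((\<lambda>\<theta>. Pfun x y (?g \<theta>)) has_vector_derivative integrand x y (?g \<theta>) * (\<i> * ?g \<theta>)) (at \<theta>)"
      using pi_gt_zero
      by (intro Pfun_curve_deriv[OF xy _ th]) (auto simp: norm_exp_eq_Re Im_exp intro!: sin_gt_zero)
    hence "(?V has_vector_derivative integrand x y (?g \<theta>) * (\<i> * ?g \<theta>) + \<i> * exp (- \<i> * y * of_real \<theta>)) (at \<theta>)"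
      by (rule has_vector_derivative_add) (rule has_vector_derivative_real_field[OF E])
    moreover have "integrand x y (?g \<theta>) * (\<i> * ?g \<theta>) + \<i> * exp (- \<i> * y * of_real \<theta>) =
      \<i> * exp (- \<i> * y * of_real \<theta> - x * (of_real (A_fun \<theta>) + \<i> * of_real ((\<theta> - pi) / 2)))"
    proof -
      have 1: "?g \<theta> powr (- y - 1) = exp (- \<i> * y * of_real \<theta>) / ?g \<theta>"
        using th by (subst powr_exp_i) (auto simp: algebra_simps simp flip: exp_diff)
      have "1 - ?g \<theta> \<noteq> 0" using th by (subst one_minus_cis_eq) auto
      hence 2: "(1 - ?g \<theta>) powr (- x) = exp (- x * (of_real (A_fun \<theta>) + \<i> * of_real ((\<theta> - pi) / 2)))"
        using th by (simp add: powr_def Ln_one_minus_cis del: of_real_divide)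
      have alg: "e / g * (w - 1) * (\<i> * g) + \<i> * e = \<i> * (e * w)" if "g \<noteq> 0" for e g w :: complex
        using that by (simp add: field_simps)
      show ?thesis unfolding integrand_def 1 2 by (subst alg) (auto simp flip: exp_add)
    qed
    ultimately show "(?V has_vector_derivative \<i> * exp (- \<i> * y * of_real \<theta> - x * (of_real (A_fun \<theta>) + \<i> * of_real ((\<theta> - pi) / 2)))) (at \<theta>)"
      by simp
  qed simp
  thus ?thesis by (simp add: rho_def)
qed

text \<open>The product is (v t / t) * t^(1 - y); the factors tend to \<open>D\<close> and, because
  Re y < 1, to 0. This handles the starting point of the arc 1 - exp(- i theta).\<close>

lemma isCont_mult_powr:
  fixes v :: "complex \<Rightarrow> complex"
  assumes "(v has_field_derivative D) (at 0)" "v 0 = 0" "norm y < 1"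
  shows "isCont (\<lambda>t. v t * t powr (- y)) 0"
proof -
  have "((\<lambda>t. v t / t * t powr (1 - y)) \<longlongrightarrow> D * 0) (at 0)"
  proof (intro tendsto_mult)
    show "(\<lambda>t. v t / t) \<midarrow>0\<rightarrow> D" using assms(1,2) by (simp add: DERIV_def)
    have "Re y < 1" using complex_Re_le_cmod[of y] assms(3) by linarith
    thus "(\<lambda>t. t powr (1 - y)) \<midarrow>0\<rightarrow> 0"
      by (intro tendsto_powr_complex_0[where b="1-y"] tendsto_intros) auto
  qed
  moreover have "\<forall>\<^sub>F t in at 0. v t / t * t powr (1 - y) = v t * t powr (- y)"
    using eventually_neq_at_within[of 0]
    by (rule eventually_mono) (auto simp: powr_diff powr_minus divide_simps)
  ultimately have "((\<lambda>t. v t * t powr (- y)) \<longlongrightarrow> 0) (at 0)"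
    by (simp add: Lim_transform_eventually)
  thus ?thesis by (simp add: isCont_def)
qed

lemma tendsto_mult_Ln_0: "(\<lambda>t. t * Ln t) \<midarrow>0\<rightarrow> 0"
proof (rule Lim_null_comparison)
  have "norm (t * Ln t) \<le> 2 * sqrt (norm t) + pi * norm t" if "t \<noteq> 0" "norm t < 1" for t :: complex
  proof -
    define r where "r = norm t"
    have r: "r > 0" "r < 1" using that by (auto simp: r_def)
    have "norm (Ln t) \<le> \<bar>Re (Ln t)\<bar> + \<bar>Im (Ln t)\<bar>" by (rule cmod_le)
    also have "\<bar>Im (Ln t)\<bar> \<le> pi" using mpi_less_Im_Ln[OF that(1)] Im_Ln_le_pi[OF that(1)] by linarith
    also have "\<bar>Re (Ln t)\<bar> = - ln r" using r that by (simp add: r_def)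
    \<comment> \<open>This is ln s \<le> s - 1 at s = 1 / sqrt r, where ln s = - ln r / 2.\<close>
    also have "- ln r \<le> 2 / sqrt r"
      using ln_le_minus_one[of "1 / sqrt r"] r by (simp add: ln_div ln_sqrt)
    finally have "r * norm (Ln t) \<le> r * (2 / sqrt r + pi)"
      using r by (intro mult_left_mono) auto
    also have "\<dots> = 2 * sqrt r + pi * r"
      using r by (simp add: field_simps)
    finally show ?thesis by (simp add: norm_mult r_def)
  qed
  thus "\<forall>\<^sub>F t in at 0. norm (t * Ln t) \<le> 2 * sqrt (norm t) + pi * norm t"
    unfolding eventually_at by (intro exI[of _ 1]) auto
  show "((\<lambda>t::complex. 2 * sqrt (norm t) + pi * norm t) \<longlongrightarrow> 0) (at 0)"
    by (auto intro!: tendsto_eq_intros)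
qed

text \<open>Again v t / t tends to \<open>D\<close>, now against t Ln t; this replaces the power
  when y = 0.\<close>

lemma isCont_mult_Ln:
  assumes "(v has_field_derivative D) (at 0)" "v 0 = 0"
  shows "isCont (\<lambda>t. v t * Ln t) 0"
proof -
  have "((\<lambda>t. v t / t * (t * Ln t)) \<longlongrightarrow> D * 0) (at 0)"
    using assms by (intro tendsto_mult tendsto_mult_Ln_0) (simp add: DERIV_def)
  moreover have "\<forall>\<^sub>F t in at 0. v t / t * (t * Ln t) = v t * Ln t"
    using eventually_neq_at_within[of 0] by (rule eventually_mono) auto
  ultimately have "((\<lambda>t. v t * Ln t) \<longlongrightarrow> 0) (at 0)"
    by (simp add: Lim_transform_eventually)
  thus ?thesis by (simp add: isCont_def assms)
qed

text \<open>Here |t|^2 = 2 - 2 cos theta, so |t| \<le> 1 holds just as long as cos theta \<ge> 1/2,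
  that is, up to theta = pi/3.\<close>

lemma arc_shift_in:
  assumes "\<theta> \<in> {0..pi/3}"
  defines "t \<equiv> 1 - exp (- \<i> * of_real \<theta>)"
  shows "norm t \<le> 1" "0 \<le> Re t" "t = 0 \<longleftrightarrow> \<theta> = 0" "Im t = sin \<theta>" "t \<noteq> 0 \<Longrightarrow> t \<notin> \<real>\<^sub>\<le>\<^sub>0" "1 - t \<notin> \<real>\<^sub>\<le>\<^sub>0"
proof -
  have c: "cos \<theta> \<ge> 1/2" using assms(1) cos_monotone_0_pi_le[of \<theta> "pi/3"] by (simp add: cos_60)
  have ReIm: "Re t = 1 - cos \<theta>" "Im t = sin \<theta>" by (auto simp: t_def Re_exp Im_exp)
  show "Im t = sin \<theta>" "0 \<le> Re t" by (auto simp: ReIm)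
  show "1 - t \<notin> \<real>\<^sub>\<le>\<^sub>0" using c by (auto simp: complex_nonpos_Reals_iff ReIm)
  have "norm t ^ 2 = 2 - 2 * cos \<theta>"
    using sin_cos_squared_add[of \<theta>] unfolding cmod_power2 ReIm by (simp add: power2_eq_square algebra_simps)
  also have "\<dots> \<le> 1 ^ 2" using c by simp
  finally show "norm t \<le> 1" by (rule power2_le_imp_le) simp
  have "sin \<theta> > 0" if "\<theta> > 0" using that assms pi_gt_zero by (intro sin_gt_zero) auto
  thus *: "t = 0 \<longleftrightarrow> \<theta> = 0" using assms(1) by (auto simp: complex_eq_iff ReIm order_le_less)
  show "t \<notin> \<real>\<^sub>\<le>\<^sub>0" if "t \<noteq> 0"
    using that \<open>\<theta> > 0 \<Longrightarrow> sin \<theta> > 0\<close> assms(1) unfolding * complex_nonpos_Reals_iff ReIm by auto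
qed

text \<open>Away from 0 the two factors are continuous separately. At 0, where \<open>w\<close> (a
  power or \<open>Ln\<close>) branches, only the product is assumed continuous; in the uses
  \<open>u\<close> vanishes there and compensates.\<close>

lemma arc_shift_continuous:
  fixes u w :: "complex \<Rightarrow> complex"
  assumes u: "continuous_on (cball 0 1 \<inter> {t. 1 - t \<notin> \<real>\<^sub>\<le>\<^sub>0}) u"
    and w: "\<And>t. t \<notin> \<real>\<^sub>\<le>\<^sub>0 \<Longrightarrow> isCont w t" and 0: "isCont (\<lambda>t. u t * w t) 0"
  shows "continuous_on {0..pi/3} (\<lambda>\<theta>. u (1 - exp (- \<i> * of_real \<theta>)) * w (1 - exp (- \<i> * of_real \<theta>)))"
proof -
  define t where "t = (\<lambda>\<theta>::real. 1 - exp (- \<i> * of_real \<theta>))"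
  let ?D = "cball 0 1 \<inter> {t. 1 - t \<notin> \<real>\<^sub>\<le>\<^sub>0}"
  have sub: "t ` {0..pi/3} \<subseteq> ?D"
    using arc_shift_in(1,6) unfolding t_def by (auto simp only: mem_cball_0 Int_iff mem_Collect_eq)
  have nz: "s \<notin> \<real>\<^sub>\<le>\<^sub>0" if "s \<in> t ` {0..pi/3}" "s \<noteq> 0" for s
    using arc_shift_in(5) that unfolding t_def by blast
  have "continuous_on (t ` {0..pi/3}) (\<lambda>t. u t * w t)"
    unfolding continuous_on_eq_continuous_within
  proof
    fix s assume s: "s \<in> t ` {0..pi/3}"
    show "continuous (at s within t ` {0..pi/3}) (\<lambda>t. u t * w t)"
    proof (cases "s = 0")
      case True
      thus ?thesis using 0 continuous_at_imp_continuous_at_within by blast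
    next
      case False
      have "continuous (at s within t ` {0..pi/3}) u"
        using continuous_on_subset[OF u sub] s unfolding continuous_on_eq_continuous_within by blast
      moreover have "continuous (at s within t ` {0..pi/3}) w"
        by (rule continuous_at_imp_continuous_at_within[OF w[OF nz[OF s False]]])
      ultimately show ?thesis by (rule Limits.continuous_mult)
    qed
  qed
  moreover have "continuous_on {0..pi/3} t" unfolding t_def by (intro continuous_intros)
  ultimately show ?thesis unfolding t_def
    by (rule continuous_on_compose2) auto
qed

text \<open>\<open>G\<close> is the boundary term of an integration by parts, which removes the derivative of \<open>A_fun\<close> from the integrand.\<close>
lemma arc_shift_integral:
  assumes xy: "norm x < 1" "norm y < 1"
    and G: "continuous_on {0..pi/3} G" "G 0 = 0" "\<And>\<theta>. \<theta> \<in> {0<..<pi/3} \<Longrightarrow> (G has_vector_derivative g \<theta> -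
      exp (- y * (of_real (A_fun \<theta>) + \<i> * of_real ((pi - \<theta>) / 2))) * (exp (\<i> * x * of_real \<theta>) - 1)
       * (\<i> * exp (- \<i> * of_real \<theta>) / (1 - exp (- \<i> * of_real \<theta>)))) (at \<theta>)"
  shows "(g has_integral Pfun x y rho + G (pi / 3)) {0..pi/3}"
proof -
  let ?t = "\<lambda>\<theta>::real. 1 - exp (- \<i> * of_real \<theta>)"
  let ?V = "\<lambda>\<theta>::real. Pfun x y (?t \<theta>) + G \<theta>"
  have "(g has_integral (?V (pi / 3) - ?V 0)) {0..pi/3}"
  proof (rule fundamental_theorem_of_calculus_interior)
    obtain h' where "(hser x y has_field_derivative h') (at 0)"
      using hser_deriv[OF xy, of 0] by auto
    moreover have "hser x y 0 = 0" by (simp add: hser_def powser_zero[of "hcoef x y", simplified] hcoef_def)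
    ultimately have "isCont (\<lambda>t. hser x y t * t powr (- y)) 0"
      using xy by (rule_tac isCont_mult_powr)
    moreover have "continuous_on (cball 0 1 \<inter> {t. 1 - t \<notin> \<real>\<^sub>\<le>\<^sub>0}) (hser x y)"
      using continuous_on_hser[OF xy] by (rule continuous_on_subset) auto
    ultimately have "continuous_on {0..pi/3} (\<lambda>\<theta>. hser x y (?t \<theta>) * ?t \<theta> powr (- y))"
      by (intro arc_shift_continuous) (auto intro!: continuous_intros)
    thus "continuous_on {0..pi/3} ?V"
      unfolding Pfun_def by (intro continuous_on_add G) (simp add: mult.commute)
  next
    fix \<theta> assume th: "\<theta> \<in> {0<..<pi/3}"
    have "(?t has_vector_derivative (\<i> * exp (- \<i> * of_real \<theta>))) (at \<theta>)"
      by (rule has_vector_derivative_real_field) (auto intro!: derivative_eq_intros)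
    moreover have "0 < Im (?t s) \<and> norm (?t s) \<le> 1" if "s \<in> {0<..<pi/3}" for s
    proof -
      have "sin s > 0" using that pi_gt_zero by (intro sin_gt_zero) (auto simp del: pi_gt_zero)
      thus ?thesis using arc_shift_in(1,4)[of s] that by auto
    qed
    ultimately have "((\<lambda>\<theta>. Pfun x y (?t \<theta>)) has_vector_derivative
        integrand x y (?t \<theta>) * (\<i> * exp (- \<i> * of_real \<theta>))) (at \<theta>)"
      by (intro Pfun_curve_deriv[OF xy _ th]) auto
    moreover have "integrand x y (?t \<theta>) * (\<i> * exp (- \<i> * of_real \<theta>)) =
      exp (- y * (of_real (A_fun \<theta>) + \<i> * of_real ((pi - \<theta>) / 2))) * (exp (\<i> * x * of_real \<theta>) - 1)
       * (\<i> * exp (- \<i> * of_real \<theta>) / ?t \<theta>)"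
    proof -
      have nz: "?t \<theta> \<noteq> 0" using th arc_shift_in(3)[of \<theta>] by auto
      have 1: "?t \<theta> powr (- y - 1) = exp (- y * (of_real (A_fun \<theta>) + \<i> * of_real ((pi - \<theta>) / 2))) / ?t \<theta>"
      proof -
        have "?t \<theta> powr (- y - 1) = ?t \<theta> powr (- y) / ?t \<theta>"
          using nz by (simp add: powr_diff)
        also have "?t \<theta> powr (- y) = exp (- y * (of_real (A_fun \<theta>) + \<i> * of_real ((pi - \<theta>) / 2)))"
          using th nz Ln_one_minus_cis'[of \<theta>] by (simp add: powr_def del: of_real_divide)
        finally show ?thesis .
      qed
      have 2: "(1 - ?t \<theta>) powr (- x) = exp (\<i> * x * of_real \<theta>)"
        using powr_exp_i(2)[of \<theta> "-x"] th by (simp add: mult_ac)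
      show ?thesis unfolding integrand_def 1 2 by simp
    qed
    ultimately have "(?V has_vector_derivative exp (- y * (of_real (A_fun \<theta>) + \<i> * of_real ((pi - \<theta>) / 2))) * (exp (\<i> * x * of_real \<theta>) - 1)
       * (\<i> * exp (- \<i> * of_real \<theta>) / ?t \<theta>) + (g \<theta> - exp (- y * (of_real (A_fun \<theta>) + \<i> * of_real ((pi - \<theta>) / 2))) * (exp (\<i> * x * of_real \<theta>) - 1)
       * (\<i> * exp (- \<i> * of_real \<theta>) / ?t \<theta>))) (at \<theta>)"
      by (intro has_vector_derivative_add G th) simp
    thus "(?V has_vector_derivative g \<theta>) (at \<theta>)" by simp
  qed simp
  moreover have "?t (pi / 3) = rho" using rho_eq by simp
  ultimately show ?thesis using G(2) by (simp add: Pfun_def)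
qed

lemma one_minus_powr_deriv_0: "((\<lambda>t. (1 - t) powr (- x) - 1) has_field_derivative x) (at (0::complex))"
  by (auto intro!: derivative_eq_intros)

lemma continuous_on_one_minus_powr:
  "continuous_on (cball 0 1 \<inter> {t. 1 - t \<notin> \<real>\<^sub>\<le>\<^sub>0}) (\<lambda>t. (1 - t) powr (- x) - 1 :: complex)"
  by (intro continuous_intros) (auto simp: complex_nonpos_Reals_iff)

text \<open>Integration by parts from t^(-y-1) dt = - d(t^(-y)) / y. Since 1 - t = exp(- i theta),
  the other factor is exp(i x theta) - 1; differentiating it produces the factor i x and leaves
  t^(-y) without its derivative.\<close>

lemma arc_shift_integral_powr:
  assumes xy: "norm x < 1" "norm y < 1" "y \<noteq> 0"
  shows "((\<lambda>\<theta>. \<i> * x / y * exp (\<i> * x * of_real \<theta> - y * (of_real (A_fun \<theta>) + \<i> * of_real ((pi - \<theta>) / 2))))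
    has_integral Pfun x y rho + (exp (\<i> * x * of_real (pi / 3)) - 1) * exp (- \<i> * y * of_real (pi / 3)) / y) {0..pi/3}"
proof -
  let ?t = "\<lambda>\<theta>::real. 1 - exp (- \<i> * of_real \<theta>)"
  define G where "G = (\<lambda>\<theta>::real. (exp (\<i> * x * of_real \<theta>) - 1) * ?t \<theta> powr (- y) / y)"
  have "((\<lambda>\<theta>. \<i> * x / y * exp (\<i> * x * of_real \<theta> - y * (of_real (A_fun \<theta>) + \<i> * of_real ((pi - \<theta>) / 2))))
    has_integral Pfun x y rho + G (pi / 3)) {0..pi/3}"
  proof (rule arc_shift_integral[OF xy(1,2)])
    have "isCont (\<lambda>t. ((1 - t) powr (- x) - 1) * t powr (- y)) 0"
      by (rule isCont_mult_powr[OF one_minus_powr_deriv_0]) (use xy in auto)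
    hence "continuous_on {0..pi/3} (\<lambda>\<theta>. ((1 - ?t \<theta>) powr (- x) - 1) * ?t \<theta> powr (- y))"
      by (intro arc_shift_continuous[of "\<lambda>t. (1 - t) powr (- x) - 1" "\<lambda>t. t powr (- y)"] continuous_on_one_minus_powr)
         (auto intro!: continuous_intros)
    hence "continuous_on {0..pi/3} (\<lambda>\<theta>. ((1 - ?t \<theta>) powr (- x) - 1) * ?t \<theta> powr (- y) / y)"
      using xy(3) by (intro continuous_on_divide[OF _ continuous_on_const]) auto
    also have "?this \<longleftrightarrow> continuous_on {0..pi/3} G"
      unfolding G_def
    proof (intro continuous_on_cong refl)
      fix \<theta> assume "\<theta> \<in> {0..pi/3}"
      hence "(1 - ?t \<theta>) powr (- x) = exp (\<i> * x * of_real \<theta>)"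
        using powr_exp_i(2)[of \<theta> "-x"] by (simp add: mult_ac)
      thus "((1 - ?t \<theta>) powr (- x) - 1) * ?t \<theta> powr (- y) / y = (exp (\<i> * x * of_real \<theta>) - 1) * ?t \<theta> powr (- y) / y"
        by simp
    qed
    finally show "continuous_on {0..pi/3} G" .
    show "G 0 = 0" by (simp add: G_def)
    fix \<theta> assume th: "\<theta> \<in> {0<..<pi/3}"
    have t: "?t \<theta> \<notin> \<real>\<^sub>\<le>\<^sub>0" "?t \<theta> \<noteq> 0" using th arc_shift_in(3,5)[of \<theta>] by auto
    define w where "w = exp (- y * (of_real (A_fun \<theta>) + \<i> * of_real ((pi - \<theta>) / 2)))"
    have w: "?t \<theta> powr (- y) = w"
      using th t Ln_one_minus_cis'[of \<theta>] by (simp add: powr_def w_def del: of_real_divide)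
    have "(G has_vector_derivative ((\<i> * x * exp (\<i> * x * of_real \<theta>)) * ?t \<theta> powr (- y) +
       (exp (\<i> * x * of_real \<theta>) - 1) * (- y * ?t \<theta> powr (- y - 1) * (\<i> * exp (- \<i> * of_real \<theta>)))) / y) (at \<theta>)"
      unfolding G_def using xy(3) t
      by (intro has_vector_derivative_real_field[of "\<lambda>z. (exp (\<i> * x * z) - 1) * (1 - exp (- \<i> * z)) powr (- y) / y"])
         (auto intro!: derivative_eq_intros)
    also have "?t \<theta> powr (- y - 1) = w / ?t \<theta>"
      using t w by (simp add: powr_diff)
    also note w
    also have "((\<i> * x * exp (\<i> * x * of_real \<theta>)) * w +
       (exp (\<i> * x * of_real \<theta>) - 1) * (- y * (w / ?t \<theta>) * (\<i> * exp (- \<i> * of_real \<theta>)))) / y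
       = \<i> * x / y * (exp (\<i> * x * of_real \<theta>) * w) - w * (exp (\<i> * x * of_real \<theta>) - 1) * (\<i> * exp (- \<i> * of_real \<theta>) / ?t \<theta>)"
    proof -
      have "(\<i> * x * a * w + (a - 1) * (- y * (w / t) * z)) / y = \<i> * x / y * (a * w) - w * (a - 1) * (z / t)"
        if "t \<noteq> 0" for a t z :: complex
        using xy(3) that by (simp add: field_simps)
      thus ?thesis using t(2) by blast
    qed
    also have "exp (\<i> * x * of_real \<theta>) * w = exp (\<i> * x * of_real \<theta> - y * (of_real (A_fun \<theta>) + \<i> * of_real ((pi - \<theta>) / 2)))"
      unfolding w_def by (simp flip: exp_add)
    finally show "(G has_vector_derivative
          \<i> * x / y * exp (\<i> * x * of_real \<theta> - y * (of_real (A_fun \<theta>) + \<i> * of_real ((pi - \<theta>) / 2))) -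
          exp (- y * (of_real (A_fun \<theta>) + \<i> * of_real ((pi - \<theta>) / 2))) * (exp (\<i> * x * of_real \<theta>) - 1) *
          (\<i> * exp (- \<i> * of_real \<theta>) / ?t \<theta>)) (at \<theta>)"
      by (simp only: w_def)
  qed
  also have "rho powr (- y) = exp (- \<i> * y * of_real (pi / 3))"
    unfolding rho_def by (subst powr_exp_i) (auto simp: mult_ac)
  hence "G (pi / 3) = (exp (\<i> * x * of_real (pi / 3)) - 1) * exp (- \<i> * y * of_real (pi / 3)) / y"
    using rho_eq by (simp add: G_def)
  finally show ?thesis .
qed

text \<open>At y = 0 the integration by parts starts from dt / t = d Ln t. The real part
  \<open>A_fun\<close> of the logarithm stays under the integral; the imaginary part is linear in
  theta and is integrated in closed form, whence the terms without an integral.\<close>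

lemma arc_shift_integral_log:
  assumes x: "norm x < 1" "x \<noteq> 0"
  shows "((\<lambda>\<theta>. - \<i> * x * of_real (A_fun \<theta>) * exp (\<i> * x * of_real \<theta>))
    has_integral Pfun x 0 rho + \<i> * of_real (pi / 3) - \<i> * of_real (pi / 2)
       + (exp (\<i> * x * of_real (pi / 3)) - 1) / (2 * x)) {0..pi/3}"
proof -
  let ?t = "\<lambda>\<theta>::real. 1 - exp (- \<i> * of_real \<theta>)"
  \<comment> \<open>A primitive of i x exp(i x z) * i (pi - z) / 2, the contribution of the argument
    of t. The second summand cancels what differentiating the factor pi - z leaves over.\<close>
  let ?E = "\<lambda>z. (of_real pi - z) * exp (\<i> * x * z) * (\<i> / 2) + exp (\<i> * x * z) / (2 * x)"
  define G where "G = (\<lambda>\<theta>::real. ?E (of_real \<theta>) - ?E 0 - (exp (\<i> * x * of_real \<theta>) - 1) * Ln (?t \<theta>))"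
  have "((\<lambda>\<theta>. - \<i> * x * of_real (A_fun \<theta>) * exp (\<i> * x * of_real \<theta>))
    has_integral Pfun x 0 rho + G (pi / 3)) {0..pi/3}"
  proof (rule arc_shift_integral[OF x(1)])
    have "isCont (\<lambda>t. ((1 - t) powr (- x) - 1) * Ln t) 0"
      by (rule isCont_mult_Ln[OF one_minus_powr_deriv_0]) (use x in auto)
    hence "continuous_on {0..pi/3} (\<lambda>\<theta>. ((1 - ?t \<theta>) powr (- x) - 1) * Ln (?t \<theta>))"
      by (intro arc_shift_continuous[of "\<lambda>t. (1 - t) powr (- x) - 1" Ln] continuous_on_one_minus_powr)
         (auto intro!: continuous_intros)
    hence "continuous_on {0..pi/3} (\<lambda>\<theta>. ?E (of_real \<theta>) - ?E 0 - ((1 - ?t \<theta>) powr (- x) - 1) * Ln (?t \<theta>))"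
      using x by (intro continuous_on_diff) (auto intro!: continuous_intros)
    also have "?this \<longleftrightarrow> continuous_on {0..pi/3} G"
      unfolding G_def
    proof (intro continuous_on_cong refl)
      fix \<theta> assume "\<theta> \<in> {0..pi/3}"
      hence "(1 - ?t \<theta>) powr (- x) = exp (\<i> * x * of_real \<theta>)"
        using powr_exp_i(2)[of \<theta> "-x"] by (simp add: mult_ac)
      thus "?E (of_real \<theta>) - ?E 0 - ((1 - ?t \<theta>) powr (- x) - 1) * Ln (?t \<theta>) =
          ?E (of_real \<theta>) - ?E 0 - (exp (\<i> * x * of_real \<theta>) - 1) * Ln (?t \<theta>)"
        by simp
    qed
    finally show "continuous_on {0..pi/3} G" .
    show "G 0 = 0" by (simp add: G_def)
    fix \<theta> assume th: "\<theta> \<in> {0<..<pi/3}"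
    have t: "?t \<theta> \<notin> \<real>\<^sub>\<le>\<^sub>0" "?t \<theta> \<noteq> 0" using th arc_shift_in(3,5)[of \<theta>] by auto
    have w: "Ln (?t \<theta>) = of_real (A_fun \<theta>) + \<i> * of_real ((pi - \<theta>) / 2)"
      using th Ln_one_minus_cis'[of \<theta>] by simp
    have "(G has_vector_derivative - exp (\<i> * x * of_real \<theta>) * (\<i> / 2) +
         (of_real pi - of_real \<theta>) * (\<i> * x * exp (\<i> * x * of_real \<theta>)) * (\<i> / 2) +
          \<i> * x * exp (\<i> * x * of_real \<theta>) / (2 * x) - ((\<i> * x * exp (\<i> * x * of_real \<theta>)) * Ln (?t \<theta>) +
       (exp (\<i> * x * of_real \<theta>) - 1) * ((\<i> * exp (- \<i> * of_real \<theta>)) / ?t \<theta>))) (at \<theta>)"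
    proof -
      have dL: "((\<lambda>z. Ln (1 - exp (- \<i> * z))) has_field_derivative (\<i> * exp (- \<i> * of_real \<theta>)) / ?t \<theta>) (at (of_real \<theta>))"
        using t by (auto intro!: derivative_eq_intros simp: divide_inverse)
      have de: "((\<lambda>z. exp (\<i> * x * z)) has_field_derivative \<i> * x * exp (\<i> * x * of_real \<theta>)) (at (of_real \<theta>))"
        by (auto intro!: derivative_eq_intros)
      have dp: "((\<lambda>z::complex. of_real pi - z) has_field_derivative - 1) (at (of_real \<theta>))"
        by (auto intro!: derivative_eq_intros)
      have dE: "(?E has_field_derivative (- 1 * exp (\<i> * x * of_real \<theta>) + (\<i> * x * exp (\<i> * x * of_real \<theta>)) * (of_real pi - of_real \<theta>)) * (\<i> / 2)
          + \<i> * x * exp (\<i> * x * of_real \<theta>) / (2 * x)) (at (of_real \<theta>))"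
        by (rule DERIV_add[OF DERIV_cmult_right[OF DERIV_mult[OF dp de]] DERIV_cdivide[OF de]])
      show ?thesis unfolding G_def
        by (rule has_vector_derivative_real_field,
            rule DERIV_cong[OF DERIV_diff[OF DERIV_diff[OF dE DERIV_const] DERIV_mult[OF DERIV_diff[OF de DERIV_const] dL]]])
           (simp add: algebra_simps)
    qed
    also note w
    also have "- exp (\<i> * x * of_real \<theta>) * (\<i> / 2) +
         (of_real pi - of_real \<theta>) * (\<i> * x * exp (\<i> * x * of_real \<theta>)) * (\<i> / 2) +
          \<i> * x * exp (\<i> * x * of_real \<theta>) / (2 * x) - ((\<i> * x * exp (\<i> * x * of_real \<theta>)) * (of_real (A_fun \<theta>) + \<i> * of_real ((pi - \<theta>) / 2)) +
       (exp (\<i> * x * of_real \<theta>) - 1) * ((\<i> * exp (- \<i> * of_real \<theta>)) / ?t \<theta>)) =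
         - \<i> * x * of_real (A_fun \<theta>) * exp (\<i> * x * of_real \<theta>) - (exp (\<i> * x * of_real \<theta>) - 1) * (\<i> * exp (- \<i> * of_real \<theta>) / ?t \<theta>)"
      using x by (simp add: algebra_simps diff_divide_distrib)
    finally show "(G has_vector_derivative
          - \<i> * x * of_real (A_fun \<theta>) * exp (\<i> * x * of_real \<theta>) -
          exp (- 0 * (of_real (A_fun \<theta>) + \<i> * of_real ((pi - \<theta>) / 2))) * (exp (\<i> * x * of_real \<theta>) - 1) *
          (\<i> * exp (- \<i> * of_real \<theta>) / ?t \<theta>)) (at \<theta>)"
      by simp
  qed simp
  moreover have "G (pi / 3) = \<i> * of_real (pi / 3) - \<i> * of_real (pi / 2)
       + (exp (\<i> * x * of_real (pi / 3)) - 1) / (2 * x)"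
  proof -
    have L: "Ln (?t (pi / 3)) = \<i> * of_real (pi / 3)"
      using rho_eq Ln_exp[of "\<i> * of_real (pi / 3)"] by (simp add: rho_def)
    show ?thesis unfolding G_def L using x by (simp add: field_simps)
  qed
  moreover have "Pfun x 0 rho + (a - b + c) = Pfun x 0 rho + a - b + c" for a b c
    by simp
  ultimately show ?thesis by metis
qed

subsection \<open>Closed integral formulas\<close>

lemma has_integral_cancel_left:
  fixes f :: "real \<Rightarrow> complex"
  assumes "((\<lambda>\<theta>. c * f \<theta>) has_integral I) S" "c \<noteq> 0"
  shows "(f has_integral I / c) S"
  using has_integral_mult_right[OF assms(1), of "inverse c"] assms(2) by (simp add: field_simps)

text \<open>Both arc formulas contain \<open>Pfun x y rho\<close>, which is eliminated between them.
  \<open>k\<close> and \<open>q\<close> are defined by solving for the integrals, so existence and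
  value are obtained together.\<close>

lemma Pfun_one_eq:
  assumes "norm x < 1" "norm y < 1" "x \<noteq> 0" "y \<noteq> 0"
  obtains k q where
    "((\<lambda>\<theta>. exp (\<i> * x * of_real \<theta> - y * (of_real (A_fun \<theta>) + \<i> * of_real ((pi - \<theta>) / 2)))) has_integral k) {0..pi/3}"
    "((\<lambda>\<theta>. exp (- \<i> * y * of_real \<theta> - x * (of_real (A_fun \<theta>) + \<i> * of_real ((\<theta> - pi) / 2)))) has_integral q) {0..pi/3}"
    "Pfun x y 1 = \<i> * x / y * k - \<i> * q + (1 - exp (\<i> * (x - y) * of_real (pi / 3))) / y"
proof -
  define ex where "ex = exp (\<i> * x * of_real (pi / 3))"
  define ey where "ey = exp (- \<i> * y * of_real (pi / 3))"
  define k where "k = (Pfun x y rho + (ex - 1) * ey / y) / (\<i> * x / y)"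
  define q where "q = ((Pfun x y rho - ey / y) - (Pfun x y 1 - 1 / y)) / \<i>"
  have "((\<lambda>\<theta>. exp (\<i> * x * of_real \<theta> - y * (of_real (A_fun \<theta>) + \<i> * of_real ((pi - \<theta>) / 2)))) has_integral k) {0..pi/3}"
    unfolding k_def ex_def ey_def
    by (rule has_integral_cancel_left[OF arc_shift_integral_powr[OF assms(1,2,4)]]) (use assms in auto)
  moreover have "((\<lambda>\<theta>. exp (- \<i> * y * of_real \<theta> - x * (of_real (A_fun \<theta>) + \<i> * of_real ((\<theta> - pi) / 2)))) has_integral q) {0..pi/3}"
  proof -
    have "((\<lambda>z. - exp (- \<i> * y * z) / y) has_field_derivative \<i> * exp (- \<i> * y * z)) (at z)" for z
      using assms by (auto intro!: derivative_eq_intros)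
    from has_integral_cancel_left[OF arc_unit_integral[OF assms(1,2) this]]
    show ?thesis by (simp add: q_def ey_def)
  qed
  moreover have "Pfun x y 1 = \<i> * x / y * k - \<i> * q + (1 - exp (\<i> * (x - y) * of_real (pi / 3))) / y"
  proof -
    have e: "exp (\<i> * (x - y) * of_real (pi / 3)) = ex * ey"
      unfolding ex_def ey_def by (simp add: algebra_simps flip: exp_add)
    have k: "Pfun x y rho = \<i> * x / y * k - (ex - 1) * ey / y"
      unfolding k_def using assms by simp
    have "Pfun x y 1 = Pfun x y rho - ey / y + 1 / y - \<i> * q"
      unfolding q_def by simp
    thus ?thesis unfolding e k by (simp add: algebra_simps diff_divide_distrib)
  qed
  ultimately show ?thesis by (rule that)
qed

text \<open>The frequency \<open>s\<close> is kept apart from \<open>x\<close> because conjugation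
  acts on them differently: (x, s) becomes (cnj x, - cnj s). The four families belong to y = x, y =
  - x and, for the last two, y = 0.\<close>

definition I_diag :: "complex \<Rightarrow> complex \<Rightarrow> complex"
  where "I_diag x s = integral {0..pi/3} (\<lambda>\<theta>. exp (- x * of_real (A_fun \<theta>) + \<i> * s * of_real ((3 * \<theta> - pi) / 2)))"

definition I_anti :: "complex \<Rightarrow> complex \<Rightarrow> complex"
  where "I_anti x s = integral {0..pi/3} (\<lambda>\<theta>. exp (- x * of_real (A_fun \<theta>) + \<i> * s * of_real ((pi + \<theta>) / 2)))"

definition I_exp :: "complex \<Rightarrow> complex \<Rightarrow> complex"
  where "I_exp x s = integral {0..pi/3} (\<lambda>\<theta>. exp (- x * of_real (A_fun \<theta>) + \<i> * s * of_real ((pi - \<theta>) / 2)))"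

definition I_log :: "complex \<Rightarrow> complex"
  where "I_log x = integral {0..pi/3} (\<lambda>\<theta>. of_real (A_fun \<theta>) * exp (\<i> * x * of_real \<theta>))"

text \<open>For y = x the boundary term is 1 - exp 0 = 0, and the phases along the two arcs are
  opposite, namely x (3 theta - pi) / 2 and its negative.\<close>

lemma Pfun_diag:
  assumes "norm x < 1" "x \<noteq> 0"
  shows "((\<lambda>\<theta>. exp (- x * of_real (A_fun \<theta>) + \<i> * x * of_real ((3 * \<theta> - pi) / 2))) has_integral I_diag x x) {0..pi/3}"
    and "((\<lambda>\<theta>. exp (- x * of_real (A_fun \<theta>) + \<i> * (- x) * of_real ((3 * \<theta> - pi) / 2))) has_integral I_diag x (- x)) {0..pi/3}"
    and "Pfun x x 1 = \<i> * (I_diag x x - I_diag x (- x))"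
proof -
  obtain k q where kq:
    "((\<lambda>\<theta>. exp (\<i> * x * of_real \<theta> - x * (of_real (A_fun \<theta>) + \<i> * of_real ((pi - \<theta>) / 2)))) has_integral k) {0..pi/3}"
    "((\<lambda>\<theta>. exp (- \<i> * x * of_real \<theta> - x * (of_real (A_fun \<theta>) + \<i> * of_real ((\<theta> - pi) / 2)))) has_integral q) {0..pi/3}"
    "Pfun x x 1 = \<i> * x / x * k - \<i> * q + (1 - exp (\<i> * (x - x) * of_real (pi / 3))) / x"
    using Pfun_one_eq[OF assms(1) assms(1) assms(2) assms(2)] by blast
  have eq1: "\<i> * x * of_real \<theta> - x * (of_real (A_fun \<theta>) + \<i> * of_real ((pi - \<theta>) / 2)) = - x * of_real (A_fun \<theta>) + \<i> * x * of_real ((3 * \<theta> - pi) / 2)" for \<theta>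
    by (simp add: field_simps)
  have 1: "((\<lambda>\<theta>. exp (- x * of_real (A_fun \<theta>) + \<i> * x * of_real ((3 * \<theta> - pi) / 2))) has_integral k) {0..pi/3}"
    using kq(1) by (simp only: eq1)
  have eq2: "- \<i> * x * of_real \<theta> - x * (of_real (A_fun \<theta>) + \<i> * of_real ((\<theta> - pi) / 2)) = - x * of_real (A_fun \<theta>) + \<i> * (- x) * of_real ((3 * \<theta> - pi) / 2)" for \<theta>
    by (simp add: field_simps)
  have 2: "((\<lambda>\<theta>. exp (- x * of_real (A_fun \<theta>) + \<i> * (- x) * of_real ((3 * \<theta> - pi) / 2))) has_integral q) {0..pi/3}"
    using kq(2) by (simp only: eq2)
  have k: "I_diag x x = k" "I_diag x (- x) = q"
    unfolding I_diag_def using 1 2 by (blast intro: integral_unique)+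
  show "((\<lambda>\<theta>. exp (- x * of_real (A_fun \<theta>) + \<i> * x * of_real ((3 * \<theta> - pi) / 2))) has_integral I_diag x x) {0..pi/3}"
    "((\<lambda>\<theta>. exp (- x * of_real (A_fun \<theta>) + \<i> * (- x) * of_real ((3 * \<theta> - pi) / 2))) has_integral I_diag x (- x)) {0..pi/3}"
    unfolding k by fact+
  show "Pfun x x 1 = \<i> * (I_diag x x - I_diag x (- x))"
    unfolding k using kq(3) assms by (simp add: algebra_simps)
qed

lemma Pfun_antidiag:
  assumes "norm x < 1" "x \<noteq> 0"
  shows "Pfun x (- x) 1 = - \<i> * (I_anti x x + I_anti (- x) x) - (1 - exp (2 * \<i> * x * of_real (pi / 3))) / x"
proof -
  have n: "norm (- x) < 1" "- x \<noteq> 0" using assms by auto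
  obtain k q where kq:
    "((\<lambda>\<theta>. exp (\<i> * x * of_real \<theta> - (-x) * (of_real (A_fun \<theta>) + \<i> * of_real ((pi - \<theta>) / 2)))) has_integral k) {0..pi/3}"
    "((\<lambda>\<theta>. exp (- \<i> * (-x) * of_real \<theta> - x * (of_real (A_fun \<theta>) + \<i> * of_real ((\<theta> - pi) / 2)))) has_integral q) {0..pi/3}"
    "Pfun x (-x) 1 = \<i> * x / (-x) * k - \<i> * q + (1 - exp (\<i> * (x - (-x)) * of_real (pi / 3))) / (-x)"
    using Pfun_one_eq[OF assms(1) n(1) assms(2) n(2)] by blast
  have eq1: "\<i> * x * of_real \<theta> - (-x) * (of_real (A_fun \<theta>) + \<i> * of_real ((pi - \<theta>) / 2)) = - (- x) * of_real (A_fun \<theta>) + \<i> * x * of_real ((pi + \<theta>) / 2)" for \<theta>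
    by (simp add: field_simps)
  have 1: "((\<lambda>\<theta>. exp (- (- x) * of_real (A_fun \<theta>) + \<i> * x * of_real ((pi + \<theta>) / 2))) has_integral k) {0..pi/3}"
    using kq(1) by (simp only: eq1)
  have eq2: "- \<i> * (-x) * of_real \<theta> - x * (of_real (A_fun \<theta>) + \<i> * of_real ((\<theta> - pi) / 2)) = - x * of_real (A_fun \<theta>) + \<i> * x * of_real ((pi + \<theta>) / 2)" for \<theta>
    by (simp add: field_simps)
  have 2: "((\<lambda>\<theta>. exp (- x * of_real (A_fun \<theta>) + \<i> * x * of_real ((pi + \<theta>) / 2))) has_integral q) {0..pi/3}"
    using kq(2) by (simp only: eq2)
  have k: "I_anti (- x) x = k" "I_anti x x = q"
    unfolding I_anti_def using 1 2 by (blast intro: integral_unique)+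
  have "x - - x = 2 * x" by simp
  thus ?thesis
    unfolding k using kq(3) assms by (simp add: algebra_simps)
qed

lemma Pfun_log:
  assumes "norm x < 1" "x \<noteq> 0"
  shows "((\<lambda>\<theta>. exp (- x * of_real (A_fun \<theta>) + \<i> * x * of_real ((pi - \<theta>) / 2))) has_integral I_exp x x) {0..pi/3}"
    and "((\<lambda>\<theta>. of_real (A_fun \<theta>) * exp (\<i> * x * of_real \<theta>)) has_integral I_log x) {0..pi/3}"
    and "Pfun x 0 1 = \<i> * of_real (pi / 2) - (exp (\<i> * x * of_real (pi / 3)) - 1) / (2 * x) - \<i> * x * I_log x - \<i> * I_exp x x"
proof -
  define R where "R = Pfun x 0 rho"
  define ex where "ex = (exp (\<i> * x * of_real (pi / 3)) - 1) / (2 * x)"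
  define m where "m = (R + \<i> * of_real (pi / 3) - \<i> * of_real (pi / 2) + ex) / (- \<i> * x)"
  define q where "q = ((R + \<i> * of_real (pi / 3)) - Pfun x 0 1) / \<i>"
  have 1: "((\<lambda>\<theta>. of_real (A_fun \<theta>) * exp (\<i> * x * of_real \<theta>)) has_integral m) {0..pi/3}"
    unfolding m_def ex_def R_def
  proof (rule has_integral_cancel_left)
    show "((\<lambda>\<theta>. - \<i> * x * (of_real (A_fun \<theta>) * exp (\<i> * x * of_real \<theta>))) has_integral
      Pfun x 0 rho + \<i> * of_real (pi / 3) - \<i> * of_real (pi / 2)
       + (exp (\<i> * x * of_real (pi / 3)) - 1) / (2 * x)) {0..pi/3}"
      using arc_shift_integral_log[OF assms] by (simp only: mult.assoc)
  qed (use assms in auto)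
  have 2: "((\<lambda>\<theta>. exp (- x * of_real (A_fun \<theta>) + \<i> * x * of_real ((pi - \<theta>) / 2))) has_integral q) {0..pi/3}"
  proof -
    \<comment> \<open>For y = 0 the term to be cancelled is the constant \<open>\<i>\<close>, so its
      primitive is linear.\<close>
    have E: "((\<lambda>z. \<i> * z) has_field_derivative \<i> * exp (- \<i> * 0 * z)) (at z)" for z
      by (auto intro!: derivative_eq_intros)
    have 0: "norm (0::complex) < 1" by simp
    have "((\<lambda>\<theta>. exp (- \<i> * 0 * of_real \<theta> - x * (of_real (A_fun \<theta>) + \<i> * of_real ((\<theta> - pi) / 2)))) has_integral q) {0..pi/3}"
      using has_integral_cancel_left[OF arc_unit_integral[OF assms(1) 0 E]]
      by (simp add: q_def R_def)
    moreover have eq: "- \<i> * 0 * of_real \<theta> - x * (of_real (A_fun \<theta>) + \<i> * of_real ((\<theta> - pi) / 2)) = - x * of_real (A_fun \<theta>) + \<i> * x * of_real ((pi - \<theta>) / 2)" for \<theta>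
      by (simp add: field_simps)
    ultimately show ?thesis by (simp only: eq)
  qed
  have k: "I_log x = m" "I_exp x x = q"
    unfolding I_log_def I_exp_def using 1 2 by (blast intro: integral_unique)+
  show "((\<lambda>\<theta>. exp (- x * of_real (A_fun \<theta>) + \<i> * x * of_real ((pi - \<theta>) / 2))) has_integral I_exp x x) {0..pi/3}"
    "((\<lambda>\<theta>. of_real (A_fun \<theta>) * exp (\<i> * x * of_real \<theta>)) has_integral I_log x) {0..pi/3}"
    unfolding k by fact+
  have "- \<i> * x * m = R + \<i> * of_real (pi / 3) - \<i> * of_real (pi / 2) + ex"
    unfolding m_def using assms by simp
  moreover have "\<i> * q = (R + \<i> * of_real (pi / 3)) - Pfun x 0 1"
    unfolding q_def by simp
  ultimately show "Pfun x 0 1 = \<i> * of_real (pi / 2) - (exp (\<i> * x * of_real (pi / 3)) - 1) / (2 * x) - \<i> * x * I_log x - \<i> * I_exp x x"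
    unfolding k ex_def[symmetric] by algebra
qed

section \<open>Complex conjugation and the parity components\<close>

lemma binc_cnj: "binc (cnj x) n = cnj (binc x n)"
  by (induction n) (simp_all add: binc_Suc)

lemma Pfun_one: "Pfun x y 1 = (\<Sum>n. hcoef x y n)"
  by (simp add: Pfun_def hser_def)

lemma Pfun_one_sums: "norm x < 1 \<Longrightarrow> norm y < 1 \<Longrightarrow> hcoef x y sums Pfun x y 1"
  unfolding Pfun_one by (intro summable_sums summable_norm_cancel[OF summable_hcoef])

text \<open>Each \<open>hcoef x y n\<close> is a rational function of x and y with real
  coefficients. Conjugating a formula at the conjugate arguments thus gives the one for the
  reflected path, without a second contour argument.\<close>

lemma Pfun_cnj:
  assumes "norm x < 1" "norm y < 1"
  shows "Pfun (cnj x) (cnj y) 1 = cnj (Pfun x y 1)"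
proof -
  have "hcoef (cnj x) (cnj y) = (\<lambda>n. cnj (hcoef x y n))"
    by (auto simp: hcoef_def binc_cnj fun_eq_iff)
  hence "hcoef (cnj x) (cnj y) sums cnj (Pfun x y 1)"
    using Pfun_one_sums[OF assms] by (simp only: sums_cnj)
  thus ?thesis using Pfun_one_sums[of "cnj x" "cnj y"] assms by (simp add: sums_unique2)
qed

lemma has_integral_I_diag:
  assumes "norm x < 1" "x \<noteq> 0" "s \<in> {x, -x}"
  shows "((\<lambda>\<theta>. exp (- x * of_real (A_fun \<theta>) + \<i> * s * of_real ((3 * \<theta> - pi) / 2))) has_integral I_diag x s) {0..pi/3}"
  using assms(3)
proof (elim insertE emptyE)
qed (use Pfun_diag(1,2)[OF assms(1,2)] in \<open>simp_all only:\<close>)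

lemma cnj_I_anti: "cnj (I_anti x s) = I_anti (cnj x) (- cnj s)"
  unfolding I_anti_def integral_cnj by (simp add: exp_cnj algebra_simps)

lemma cnj_I_exp: "cnj (I_exp x s) = I_exp (cnj x) (- cnj s)"
  unfolding I_exp_def integral_cnj by (simp add: exp_cnj algebra_simps)

lemma cnj_I_log: "cnj (I_log x) = I_log (- cnj x)"
  unfolding I_log_def integral_cnj by (simp add: exp_cnj algebra_simps)

text \<open>The reflected formula for \<open>Pfun x (- x) 1\<close> is the negative of the direct
  formula with \<open>- x\<close> for \<open>x\<close>, because the sum of the two
  \<open>I_anti\<close> terms is symmetric in the sign of the first argument. On coefficients this
  says that for odd w the sum of (-1)^n zeta({1}^m, n+2) over m + n = w is 0, a consequence of
  duality that is reached here without it.\<close>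

lemma Pfun_antidiag_cancel:
  assumes "norm x < 1" "x \<noteq> 0"
  shows "Pfun x (- x) 1 + Pfun (- x) x 1 = 0"
proof -
  have "Pfun x (- x) 1 = cnj (Pfun (cnj x) (- cnj x) 1)"
    using Pfun_cnj[of "cnj x" "- cnj x"] assms by simp
  also have "Pfun (cnj x) (- cnj x) 1 = - \<i> * (I_anti (cnj x) (cnj x) + I_anti (- cnj x) (cnj x)) - (1 - exp (2 * \<i> * cnj x * of_real (pi / 3))) / cnj x"
    using assms by (intro Pfun_antidiag) auto
  also have "cnj \<dots> = \<i> * (I_anti x (- x) + I_anti (- x) (- x)) - (1 - exp (- 2 * \<i> * x * of_real (pi / 3))) / x"
    by (simp add: cnj_I_anti exp_cnj)
  also have "\<dots> = - Pfun (- x) (- (- x)) 1"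
    using Pfun_antidiag[of "-x"] assms by (simp add: algebra_simps)
  finally show ?thesis by simp
qed

lemma Pfun_log_cnj:
  assumes "norm x < 1" "x \<noteq> 0"
  shows "((\<lambda>\<theta>. exp (- x * of_real (A_fun \<theta>) + \<i> * (- x) * of_real ((pi - \<theta>) / 2))) has_integral I_exp x (- x)) {0..pi/3}"
    and "Pfun x 0 1 = - \<i> * of_real (pi / 2) - (exp (- \<i> * x * of_real (pi / 3)) - 1) / (2 * x) + \<i> * x * I_log (- x) + \<i> * I_exp x (- x)"
proof -
  have x: "norm (cnj x) < 1" "cnj x \<noteq> 0" using assms by auto
  show "((\<lambda>\<theta>. exp (- x * of_real (A_fun \<theta>) + \<i> * (- x) * of_real ((pi - \<theta>) / 2))) has_integral I_exp x (- x)) {0..pi/3}"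
    using has_integral_linear[OF Pfun_log(1)[OF x] bounded_linear_cnj]
    by (simp add: o_def exp_cnj cnj_I_exp algebra_simps)
  have "Pfun x 0 1 = cnj (Pfun (cnj x) 0 1)"
    using Pfun_cnj[of "cnj x" 0] assms by simp
  also note Pfun_log(3)[OF x]
  also have "cnj (\<i> * of_real (pi / 2) - (exp (\<i> * cnj x * of_real (pi / 3)) - 1) / (2 * cnj x) - \<i> * cnj x * I_log (cnj x) - \<i> * I_exp (cnj x) (cnj x))
     = - \<i> * of_real (pi / 2) - (exp (- \<i> * x * of_real (pi / 3)) - 1) / (2 * x) + \<i> * x * I_log (- x) + \<i> * I_exp x (- x)"
    by (simp add: cnj_I_exp cnj_I_log exp_cnj)
  finally show "Pfun x 0 1 = - \<i> * of_real (pi / 2) - (exp (- \<i> * x * of_real (pi / 3)) - 1) / (2 * x) + \<i> * x * I_log (- x) + \<i> * I_exp x (- x)" .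
qed

definition Kfun :: "complex \<Rightarrow> complex"
  where "Kfun X = (Pfun X X 1 + Pfun (- X) X 1 + Pfun X (- X) 1 + Pfun (- X) (- X) 1) / 4"

definition Wfun :: "complex \<Rightarrow> complex"
  where "Wfun X = (Pfun X 0 1 + Pfun (- X) 0 1) / 2"

lemma Kfun_eq:
  assumes "norm X < 1" "X \<noteq> 0"
  shows "Kfun X = \<i> / 4 * (I_diag X X - I_diag X (- X) + I_diag (- X) (- X) - I_diag (- X) X)"
proof -
  have "Kfun X = (Pfun X X 1 + Pfun (- X) (- X) 1 + (Pfun X (- X) 1 + Pfun (- X) X 1)) / 4"
    by (simp add: Kfun_def algebra_simps)
  also have "Pfun (- X) (- X) 1 = \<i> * (I_diag (- X) (- X) - I_diag (- X) X)"
    using assms Pfun_diag(3)[of "- X"] by simp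
  finally show ?thesis
    unfolding Pfun_diag(3)[OF assms] Pfun_antidiag_cancel[OF assms] by (simp add: field_simps)
qed

text \<open>Pairing the direct formula at \<open>X\<close> with the reflected one at
  \<open>- X\<close> removes the terms \<open>a\<close> and \<open>b\<close>; the opposite pairing
  removes \<open>a\<close> and \<open>c\<close>. Both expressions are needed: one is matched with
  exp(i pi X), the other with exp(- i pi X).\<close>

lemma Wfun_eq:
  assumes "norm X < 1" "X \<noteq> 0"
  shows "Wfun X = - \<i> * X * I_log X - \<i> / 2 * I_exp X X + \<i> / 2 * I_exp (- X) X"
    and "Wfun X = \<i> * X * I_log (- X) + \<i> / 2 * I_exp X (- X) - \<i> / 2 * I_exp (- X) (- X)"
proof -
  have X: "norm (- X) < 1" "- X \<noteq> 0" using assms by auto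
  define a where "a = \<i> * of_real (pi / 2)"
  define b where "b = (exp (\<i> * X * of_real (pi / 3)) - 1) / (2 * X)"
  define c where "c = (exp (- \<i> * X * of_real (pi / 3)) - 1) / (2 * X)"
  have "Pfun X 0 1 = a - b - \<i> * X * I_log X - \<i> * I_exp X X"
       "Pfun X 0 1 = - a - c + \<i> * X * I_log (- X) + \<i> * I_exp X (- X)"
       "Pfun (- X) 0 1 = a + c + \<i> * X * I_log (- X) - \<i> * I_exp (- X) (- X)"
       "Pfun (- X) 0 1 = - a + b - \<i> * X * I_log X + \<i> * I_exp (- X) X"
    using Pfun_log(3)[OF assms] Pfun_log_cnj(2)[OF assms] Pfun_log(3)[OF X] Pfun_log_cnj(2)[OF X]
    by (simp_all add: a_def b_def c_def)
  note P = this
  show "Wfun X = - \<i> * X * I_log X - \<i> / 2 * I_exp X X + \<i> / 2 * I_exp (- X) X"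
    unfolding Wfun_def P(1) P(4) by (simp add: field_simps)
  show "Wfun X = \<i> * X * I_log (- X) + \<i> / 2 * I_exp X (- X) - \<i> / 2 * I_exp (- X) (- X)"
    unfolding Wfun_def P(2) P(3) by (simp add: field_simps)
qed

section \<open>The two integrals of the theorem\<close>

lemma sin_exp_pair: "sin z = (exp (\<i> * z) - exp (- \<i> * z)) / (2 * \<i>)" for z :: complex
  by (simp add: sin_exp_eq)

lemma integral_sin_A:
  assumes "norm X < 1" "X \<noteq> 0"
  shows "integral {0..pi/3} (\<lambda>\<theta>. sin ((of_real \<theta> + of_real pi) * X) * of_real (A_fun \<theta>)) =
    (exp (\<i> * (of_real pi * X)) * I_log X - exp (- \<i> * (of_real pi * X)) * I_log (- X)) / (2 * \<i>)"
proof (rule integral_unique)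
  have X: "norm (- X) < 1" "- X \<noteq> 0" using assms by auto
  have "((\<lambda>\<theta>. (exp (\<i> * (of_real pi * X)) * (of_real (A_fun \<theta>) * exp (\<i> * X * of_real \<theta>))
      - exp (- \<i> * (of_real pi * X)) * (of_real (A_fun \<theta>) * exp (\<i> * (- X) * of_real \<theta>))) / (2 * \<i>))
     has_integral (exp (\<i> * (of_real pi * X)) * I_log X - exp (- \<i> * (of_real pi * X)) * I_log (- X)) / (2 * \<i>)) {0..pi/3}"
    by (intro has_integral_divide has_integral_diff has_integral_mult_right Pfun_log(2) assms X)
  also have "(\<lambda>\<theta>. (exp (\<i> * (of_real pi * X)) * (of_real (A_fun \<theta>) * exp (\<i> * X * of_real \<theta>))
      - exp (- \<i> * (of_real pi * X)) * (of_real (A_fun \<theta>) * exp (\<i> * (- X) * of_real \<theta>))) / (2 * \<i>)) =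
      (\<lambda>\<theta>. sin ((of_real \<theta> + of_real pi) * X) * of_real (A_fun \<theta>))"
  proof
    fix \<theta>
    have "exp (\<i> * ((of_real \<theta> + of_real pi) * X)) = exp (\<i> * (of_real pi * X)) * exp (\<i> * X * of_real \<theta>)"
      "exp (- \<i> * ((of_real \<theta> + of_real pi) * X)) = exp (- \<i> * (of_real pi * X)) * exp (\<i> * (- X) * of_real \<theta>)"
      by (simp_all add: algebra_simps flip: exp_add)
    thus "(exp (\<i> * (of_real pi * X)) * (of_real (A_fun \<theta>) * exp (\<i> * X * of_real \<theta>))
      - exp (- \<i> * (of_real pi * X)) * (of_real (A_fun \<theta>) * exp (\<i> * (- X) * of_real \<theta>))) / (2 * \<i>) =
      sin ((of_real \<theta> + of_real pi) * X) * of_real (A_fun \<theta>)"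
      unfolding sin_exp_pair by (simp only:) (simp add: algebra_simps)
  qed
  finally show "((\<lambda>\<theta>. sin ((of_real \<theta> + of_real pi) * X) * of_real (A_fun \<theta>)) has_integral
    (exp (\<i> * (of_real pi * X)) * I_log X - exp (- \<i> * (of_real pi * X)) * I_log (- X)) / (2 * \<i>)) {0..pi/3}" .
qed

text \<open>The product formula for sin and cos produces the angles (3 theta - pi) / 2, the phase of
  \<open>I_diag\<close>, and (3 pi - theta) / 2 = pi + (pi - theta) / 2. The second is the phase of
  \<open>I_exp\<close> after splitting off pi, which gives the factors \<open>p\<close> and
  \<open>q\<close>.\<close>

lemma integral_sinh_sin_cos:
  assumes "norm X < 1" "X \<noteq> 0"
  defines "p \<equiv> exp (\<i> * (of_real pi * X))" and "q \<equiv> exp (- \<i> * (of_real pi * X))"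
  shows "2 * integral {0..pi/3} (\<lambda>\<theta>. sinh (of_real (A_fun \<theta>) * X)
                     * sin ((of_real \<theta> + of_real pi) / 2 * X) * cos ((of_real \<theta> - of_real pi) * X)) =
    (I_diag (- X) X - I_diag (- X) (- X) - I_diag X X + I_diag X (- X)
     + (p * (I_exp (- X) X - I_exp X X) - q * (I_exp (- X) (- X) - I_exp X (- X)))) / (4 * \<i>)"
proof -
  have X: "norm (- X) < 1" "- X \<noteq> 0" using assms by auto
  define D where "D = (\<lambda>x s \<theta>. exp (- x * of_real (A_fun \<theta>) + \<i> * s * of_real ((3 * \<theta> - pi) / 2)))"
  define E where "E = (\<lambda>x s \<theta>. exp (- x * of_real (A_fun \<theta>) + \<i> * s * of_real ((pi - \<theta>) / 2)))"
  have D: "(D x s has_integral I_diag x s) {0..pi/3}" if "x \<in> {X, - X}" "s \<in> {X, - X}" for x s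
    unfolding D_def using that assms by (intro has_integral_I_diag) auto
  note e = Pfun_log(1)[OF assms(1,2)] Pfun_log(1)[OF X] Pfun_log_cnj(1)[OF assms(1,2)] Pfun_log_cnj(1)[OF X]
  have E: "(E x s has_integral I_exp x s) {0..pi/3}" if "x \<in> {X, - X}" "s \<in> {X, - X}" for x s
    unfolding E_def using that
  proof (elim insertE emptyE)
  qed (use e in \<open>simp_all only: minus_minus\<close>)
  have "((\<lambda>\<theta>. ((D (- X) X \<theta> - D (- X) (- X) \<theta> - D X X \<theta> + D X (- X) \<theta>
     + (p * (E (- X) X \<theta> - E X X \<theta>) - q * (E (- X) (- X) \<theta> - E X (- X) \<theta>))) / (4 * \<i>)) / 2)
    has_integral ((I_diag (- X) X - I_diag (- X) (- X) - I_diag X X + I_diag X (- X)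
     + (p * (I_exp (- X) X - I_exp X X) - q * (I_exp (- X) (- X) - I_exp X (- X)))) / (4 * \<i>)) / 2) {0..pi/3}"
    by (intro has_integral_divide has_integral_add has_integral_diff has_integral_mult_right D E) auto
  also have "(\<lambda>\<theta>. ((D (- X) X \<theta> - D (- X) (- X) \<theta> - D X X \<theta> + D X (- X) \<theta>
     + (p * (E (- X) X \<theta> - E X X \<theta>) - q * (E (- X) (- X) \<theta> - E X (- X) \<theta>))) / (4 * \<i>)) / 2) =
     (\<lambda>\<theta>. sinh (of_real (A_fun \<theta>) * X)
                     * sin ((of_real \<theta> + of_real pi) / 2 * X) * cos ((of_real \<theta> - of_real pi) * X))"
  proof
    fix \<theta> :: real
    define s where "s = exp (of_real (A_fun \<theta>) * X)"
    define s' where "s' = exp (- of_real (A_fun \<theta>) * X)"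
    define f where "f = exp (\<i> * (of_real ((3 * \<theta> - pi) / 2) * X))"
    define f' where "f' = exp (- \<i> * (of_real ((3 * \<theta> - pi) / 2) * X))"
    define g where "g = exp (\<i> * (of_real ((pi - \<theta>) / 2) * X))"
    define g' where "g' = exp (- \<i> * (of_real ((pi - \<theta>) / 2) * X))"
    have sh: "sinh (of_real (A_fun \<theta>) * X) = (s - s') / 2"
      by (simp add: sinh_field_def s_def s'_def)
    have sc: "sin ((of_real \<theta> + of_real pi) / 2 * X) * cos ((of_real \<theta> - of_real pi) * X) =
      (sin (of_real ((3 * \<theta> - pi) / 2) * X) + sin (of_real pi * X + of_real ((pi - \<theta>) / 2) * X)) / 2"
      unfolding sin_times_cos by (intro arg_cong2[where f="\<lambda>a b. (sin a + sin b) / 2"]) (simp_all add: field_simps)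
    have s1: "sin (of_real ((3 * \<theta> - pi) / 2) * X) = (f - f') / (2 * \<i>)"
      unfolding sin_exp_pair f_def f'_def ..
    have s2: "sin (of_real pi * X + of_real ((pi - \<theta>) / 2) * X) = (p * g - q * g') / (2 * \<i>)"
      unfolding sin_exp_pair g_def g'_def p_def q_def by (simp add: ring_distribs flip: exp_add)
    have DE: "D (- X) X \<theta> = s * f" "D (- X) (- X) \<theta> = s * f'" "D X X \<theta> = s' * f" "D X (- X) \<theta> = s' * f'"
      "E (- X) X \<theta> = s * g" "E (- X) (- X) \<theta> = s * g'" "E X X \<theta> = s' * g" "E X (- X) \<theta> = s' * g'"
      unfolding D_def E_def s_def s'_def f_def f'_def g_def g'_def exp_add[symmetric]
      by (simp_all add: mult_ac)
    show "((D (- X) X \<theta> - D (- X) (- X) \<theta> - D X X \<theta> + D X (- X) \<theta>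
     + (p * (E (- X) X \<theta> - E X X \<theta>) - q * (E (- X) (- X) \<theta> - E X (- X) \<theta>))) / (4 * \<i>)) / 2 =
     sinh (of_real (A_fun \<theta>) * X)
                     * sin ((of_real \<theta> + of_real pi) / 2 * X) * cos ((of_real \<theta> - of_real pi) * X)"
      unfolding mult.assoc sc sh s1 s2 DE by (simp add: field_simps)
  qed
  finally show ?thesis by (simp add: integral_unique)
qed

lemma integral_side:
  assumes "norm X < 1" "X \<noteq> 0"
  shows "X * integral {0..pi/3} (\<lambda>\<theta>. sin ((of_real \<theta> + of_real pi) * X) * of_real (A_fun \<theta>))
       - 2 * integral {0..pi/3} (\<lambda>\<theta>. sinh (of_real (A_fun \<theta>) * X)
                     * sin ((of_real \<theta> + of_real pi) / 2 * X) * cos ((of_real \<theta> - of_real pi) * X))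
     = cos (of_real pi * X) * Wfun X - Kfun X"
proof -
  define p where "p = exp (\<i> * (of_real pi * X))"
  define q where "q = exp (- \<i> * (of_real pi * X))"
  have c: "cos (of_real pi * X) * Wfun X = p * Wfun X / 2 + q * Wfun X / 2"
    unfolding cos_exp_eq p_def q_def by (simp add: field_simps)
  show ?thesis
    unfolding integral_sin_A[OF assms] integral_sinh_sin_cos[OF assms] Kfun_eq[OF assms] c
      p_def[symmetric] q_def[symmetric]
    \<comment> \<open>The summand with \<open>p\<close> receives the expression in
      \<open>I_log X\<close>, the one with \<open>q\<close> the expression in
      \<open>I_log (- X)\<close>, just as they occur in the sine integral.\<close>
    by (subst (1) Wfun_eq(1)[OF assms], subst Wfun_eq(2)[OF assms]) (simp add: field_simps)
qed

subsection \<open>The generating function of multiple zeta values\<close>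

text \<open>N itself is left out: it is the largest summation index of the multiple zeta value, and
  the m indices with exponent 1 lie below it.\<close>

definition esubsets :: "nat \<Rightarrow> nat \<Rightarrow> nat set set"
  where "esubsets m N = {S. S \<subseteq> {1..<N} \<and> card S = m}"

definition esym :: "nat \<Rightarrow> nat \<Rightarrow> real"
  where "esym m N = (\<Sum>S\<in>esubsets m N. \<Prod>j\<in>S. 1 / real j)"

lemma finite_esubsets: "finite (esubsets m N)"
  by (rule finite_subset[of _ "Pow {1..<N}"]) (auto simp: esubsets_def)

lemma esym_nonneg: "0 \<le> esym m N"
  unfolding esym_def by (intro sum_nonneg prod_nonneg) auto

lemma esym_0: "esym 0 N = 1"
proof -
  have "esubsets 0 N = {{}}"
    using finite_subset[OF _ finite_atLeastLessThan] by (auto simp: esubsets_def)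
  thus ?thesis by (simp add: esym_def)
qed

lemma esubsets_card_less: "S \<subseteq> {1..<N} \<Longrightarrow> N \<ge> 1 \<Longrightarrow> card S < N"
  using card_mono[of "{1..<N}" S] by simp

lemma esym_eq_0: "N \<le> m \<Longrightarrow> N \<ge> 1 \<Longrightarrow> esym m N = 0"
proof -
  assume "N \<le> m" "N \<ge> 1"
  hence "esubsets m N = {}"
    by (auto simp: esubsets_def simp del: One_nat_def dest: esubsets_card_less)
  thus ?thesis by (simp add: esym_def)
qed

text \<open>Both sides are x (x + 1) ... (x + N - 1) / (N - 1)!.\<close>

lemma prod_one_plus_eq_binc:
  fixes x :: "'a::field_char_0"
  assumes "N \<ge> 1"
  shows "x * (\<Prod>j\<in>{1..<N}. 1 + x / of_nat j) = of_nat N * binc x N"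
  using assms
proof (induction N rule: dec_induct)
  case (step n)
  have "x * (\<Prod>j\<in>{1..<Suc n}. 1 + x / of_nat j) = (x * (\<Prod>j\<in>{1..<n}. 1 + x / of_nat j)) * (1 + x / of_nat n)"
    using step by (simp add: prod.op_ivl_Suc)
  also have "\<dots> = of_nat (Suc n) * binc x (Suc n)"
    unfolding step.IH binc_Suc using step by (simp add: field_simps del: of_nat_Suc)
  finally show ?case .
qed (simp add: binc_Suc)

text \<open>The product is expanded over subsets and grouped by cardinality. Only m < N contribute;
  the sum is put over all m so that it can serve as an inner sum.\<close>

lemma esym_has_sum:
  fixes x :: "'a::{real_normed_field,banach}"
  assumes "N \<ge> 1"
  shows "((\<lambda>m. of_real (esym m N) * x ^ Suc m) has_sum of_nat N * binc x N) UNIV"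
proof (rule has_sum_finite_neutralI[of "{..<N}"])
  have "(\<Prod>j\<in>{1..<N}. 1 + x / of_nat j) = (\<Prod>j\<in>{1..<N}. x / of_nat j + 1)"
    by (simp add: add.commute)
  also have "\<dots> = (\<Sum>S\<in>Pow {1..<N}. \<Prod>j\<in>S. x / of_nat j)"
    by (subst prod_add) auto
  also have "\<dots> = (\<Sum>m<N. \<Sum>S\<in>{S\<in>Pow {1..<N}. card S = m}. \<Prod>j\<in>S. x / of_nat j)"
  proof (intro sum.group[symmetric])
    show "card ` Pow {1..<N} \<subseteq> {..<N}"
      using esubsets_card_less assms by blast
  qed auto
  also have "\<dots> = (\<Sum>m<N. of_real (esym m N) * x ^ m)"
  proof (intro sum.cong refl)
    fix m
    have "(\<Prod>j\<in>S. x / of_nat j) = of_real (\<Prod>j\<in>S. 1 / real j) * x ^ m" if "S \<in> esubsets m N" for S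
      using that by (simp add: esubsets_def prod_dividef)
    thus "(\<Sum>S\<in>{S\<in>Pow {1..<N}. card S = m}. \<Prod>j\<in>S. x / of_nat j) = of_real (esym m N) * x ^ m"
      unfolding esym_def of_real_sum sum_distrib_right
      by (intro sum.cong) (auto simp: esubsets_def)
  qed
  finally show "of_nat N * binc x N = (\<Sum>m<N. of_real (esym m N) * x ^ Suc m)"
    unfolding prod_one_plus_eq_binc[OF assms, symmetric] by (simp add: sum_distrib_left mult_ac)
qed (use assms esym_eq_0 in auto)

lemma geometric_tail_has_sum:
  fixes y :: "'a::{real_normed_field,banach}"
  assumes "norm y < 1" "N \<ge> 1"
  shows "((\<lambda>n. y ^ n / of_nat N ^ (n + 2)) has_sum (1 / (of_nat N * (of_nat N - y)))) UNIV"
proof -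
  have n: "norm (y / of_nat N) < 1"
    using assms by (simp add: norm_divide divide_less_eq)
  have "of_nat N - y \<noteq> 0"
  proof
    assume "of_nat N - y = 0"
    hence "norm y = real N" by (metis eq_iff_diff_eq_0 norm_of_nat)
    thus False using assms by simp
  qed
  hence eq: "1 / of_nat N ^ 2 * (1 / (1 - y / of_nat N)) = 1 / (of_nat N * (of_nat N - y))"
    using assms by (simp add: field_simps power2_eq_square)
  have "(\<lambda>n. 1 / of_nat N ^ 2 * (y / of_nat N) ^ n) sums (1 / of_nat N ^ 2 * (1 / (1 - y / of_nat N)))"
    using geometric_sums[OF n] by (rule sums_mult)
  moreover have "1 / of_nat N ^ 2 * (y / of_nat N) ^ n = y ^ n / of_nat N ^ (n + 2)" for n
    by (simp add: power_divide power_add power2_eq_square)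
  moreover have "summable (\<lambda>n. norm (1 / of_nat N ^ 2 * (y / of_nat N) ^ n))"
    using n by (simp add: norm_mult norm_power norm_divide power_divide[symmetric] summable_geometric summable_mult)
  ultimately show ?thesis unfolding eq by (intro norm_summable_imp_has_sum) auto
qed

text \<open>The summand behind \<open>Pfun x y 1\<close>. Summing over n and m with N fixed gives
  \<open>hcoef x y N\<close>; summing over N with m and n fixed gives a multiple zeta value with its
  weight.\<close>

definition gterm :: "'a::{real_normed_field,banach} \<Rightarrow> 'a \<Rightarrow> nat \<times> nat \<times> nat \<Rightarrow> 'a"
  where "gterm x y = (\<lambda>(N, m, n). (of_real (esym m N) * x ^ Suc m) * (y ^ n / of_nat N ^ (n + 2)))"

lemma gterm_inner:
  fixes x y :: "'a::{real_normed_field,banach}"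
  assumes "norm y < 1" "N \<ge> 1"
  shows "((\<lambda>n. gterm x y (N, m, n)) has_sum (of_real (esym m N) * x ^ Suc m) * (1 / (of_nat N * (of_nat N - y)))) UNIV"
    and "((\<lambda>m. (of_real (esym m N) * x ^ Suc m) * (1 / (of_nat N * (of_nat N - y)))) has_sum binc x N / (of_nat N - y)) UNIV"
proof -
  show "((\<lambda>n. gterm x y (N, m, n)) has_sum (of_real (esym m N) * x ^ Suc m) * (1 / (of_nat N * (of_nat N - y)))) UNIV"
    unfolding gterm_def prod.case by (intro has_sum_cmult_right geometric_tail_has_sum assms)
  show "((\<lambda>m. (of_real (esym m N) * x ^ Suc m) * (1 / (of_nat N * (of_nat N - y)))) has_sum binc x N / (of_nat N - y)) UNIV"
    using has_sum_cmult_left[OF esym_has_sum[OF assms(2), of x], of "1 / (of_nat N * (of_nat N - y))"] assms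
    by simp
qed

text \<open>For nonnegative terms summability of the iterated sums suffices, and these are known in
  closed form. The result dominates the complex family and also yields convergence of the multiple
  zeta series.\<close>

lemma gterm_summable_real:
  fixes x y :: real
  assumes "0 \<le> x" "x < 1" "0 \<le> y" "y < 1"
  shows "gterm x y summable_on ({1..} \<times> UNIV \<times> UNIV)"
proof (rule summable_on_SigmaI)
  have y: "norm y < 1" using assms by simp
  have nn: "0 \<le> gterm x y (N, m, n)" for N m n
    using assms by (simp add: gterm_def esym_nonneg)
  show "0 \<le> gterm x y (N, mn)" for N mn using nn by (cases mn) auto
  fix N :: nat assume "N \<in> {1..}"
  hence N: "N \<ge> 1" by simp
  show "((\<lambda>mn. gterm x y (N, mn)) has_sum binc x N / (real N - y)) (UNIV \<times> UNIV)"
  proof (rule has_sum_SigmaI[OF gterm_inner(1)[OF y N] gterm_inner(2)[OF y N]])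
    show "(\<lambda>mn. gterm x y (N, mn)) summable_on UNIV \<times> UNIV"
      by (rule summable_on_SigmaI[OF gterm_inner(1)[OF y N] has_sum_imp_summable[OF gterm_inner(2)[OF y N]]]) (rule nn)
  qed
next
  have "summable (\<lambda>N. norm (binc x N / real N / (1 - y)))"
    using summable_divide[OF summable_binc_div[OF assms(1,2)], of "1 - y"] assms binc_nonneg[OF assms(1)]
    by simp
  hence "summable (\<lambda>N. norm (if N = 0 then 0 else binc x N / (real N - y)))"
  proof (rule summable_comparison_test')
    fix N :: nat
    have "real N * (1 - y) \<le> real N - y" if "N \<noteq> 0"
      using that mult_right_mono[of 1 "real N" y] assms by (simp add: algebra_simps)
    hence "N \<noteq> 0 \<Longrightarrow> binc x N / (real N - y) \<le> binc x N / (real N * (1 - y))"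
      using assms binc_nonneg[OF assms(1)] by (intro divide_left_mono) (auto intro!: mult_pos_pos)
    thus "norm (norm (if N = 0 then 0 else binc x N / (real N - y))) \<le> norm (binc x N / real N / (1 - y))"
      using assms binc_nonneg[OF assms(1), of N] by (auto intro!: divide_nonneg_nonneg)
  qed
  hence "(\<lambda>N. if N = 0 then 0 else binc x N / (real N - y)) summable_on UNIV"
    by (rule norm_summable_imp_summable_on)
  hence "(\<lambda>N. if N = 0 then 0 else binc x N / (real N - y)) summable_on {1..}"
    by (rule summable_on_subset_banach) auto
  thus "(\<lambda>N. binc x N / (real N - y)) summable_on {1..}"
    by (subst (asm) summable_on_cong) auto
qed

text \<open>The norm of \<open>gterm x y\<close> is \<open>gterm (norm x) (norm y)\<close>, so the
  real case gives absolute summability and hence the right to sum in any order.\<close>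

lemma gterm_has_sum:
  fixes x y :: complex
  assumes "norm x < 1" "norm y < 1"
  shows "(gterm x y has_sum Pfun x y 1) ({1..} \<times> UNIV \<times> UNIV)"
proof -
  have "norm (gterm x y p) = gterm (norm x) (norm y) p" for p
    by (cases p) (simp add: gterm_def norm_mult norm_divide norm_power esym_nonneg)
  hence "(\<lambda>p. norm (gterm x y p)) summable_on ({1..} \<times> UNIV \<times> UNIV)"
    using gterm_summable_real[of "norm x" "norm y"] assms by simp
  hence s: "gterm x y summable_on ({1..} \<times> UNIV \<times> UNIV)"
    by (rule abs_summable_summable)
  show ?thesis
  proof (rule has_sum_SigmaI[OF _ _ s])
    fix N :: nat assume N': "N \<in> {1..}"
    hence N: "N \<ge> 1" by simp
    have "(\<lambda>mn. gterm x y (N, mn)) summable_on (UNIV \<times> UNIV)"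
      using summable_on_SigmaD1[of "\<lambda>N mn. gterm x y (N, mn)" "{1..}" "\<lambda>_. UNIV \<times> UNIV" N] s N' by simp
    thus "((\<lambda>mn. gterm x y (N, mn)) has_sum binc x N / (of_nat N - y)) (UNIV \<times> UNIV)"
      by (rule has_sum_SigmaI[OF gterm_inner(1)[OF assms(2) N] gterm_inner(2)[OF assms(2) N]])
  next
    have "(hcoef x y has_sum Pfun x y 1) UNIV"
      by (rule norm_summable_imp_has_sum[OF summable_hcoef[OF assms] Pfun_one_sums[OF assms]])
    also have "?this \<longleftrightarrow> ((\<lambda>N. binc x N / (of_nat N - y)) has_sum Pfun x y 1) {1..}"
      by (rule has_sum_cong_neutral) (auto simp: hcoef_def)
    finally show "((\<lambda>N. binc x N / (of_nat N - y)) has_sum Pfun x y 1) {1..}" .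
  qed
qed

text \<open>An increasing list of positive indices is its last entry N together with the set S of
  the earlier ones. Since \<open>infsum\<close> is 0 on families that are not summable, summability
  over lists has to be proved before \<open>mzv\<close> can be evaluated.\<close>

lemma mzv_has_sum:
  "((\<lambda>N. esym m N / real N ^ (n + 2)) has_sum mzv (replicate m 1 @ [n + 2])) {1..}"
proof -
  define ks where "ks = replicate m 1 @ [n + 2]"
  define t where "t = (\<lambda>ms::nat list. \<Prod>i<length ks. 1 / real (ms ! i) ^ (ks ! i))"
  define M where "M = {ms::nat list. length ms = length ks \<and> sorted_wrt (<) ms \<and> 0 \<notin> set ms}"
  define h where "h = (\<lambda>(N::nat, S). sorted_list_of_set S @ [N])"
  have bij: "bij_betw h (SIGMA N:{1..}. esubsets m N) M"
  proof (rule bij_betw_byWitness[where f' = "\<lambda>ms. (last ms, set (butlast ms))"])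
    have fin: "finite S" if "S \<in> esubsets m N" for S N
      using that finite_subset[OF _ finite_atLeastLessThan] by (auto simp: esubsets_def)
    show "\<forall>a\<in>SIGMA N:{1..}. esubsets m N. (last (h a), set (butlast (h a))) = a"
      using fin by (auto simp: h_def)
    show "h ` (SIGMA N:{1..}. esubsets m N) \<subseteq> M"
    proof safe
      fix N S assume N: "(1::nat) \<le> N" and S: "S \<in> esubsets m N"
      show "h (N, S) \<in> M"
        using N S fin[OF S]
        by (auto simp: h_def M_def ks_def esubsets_def sorted_wrt_append)
    qed
    have dec: "\<exists>xs N. ms = xs @ [N] \<and> length xs = m" if "ms \<in> M" for ms
      using that by (cases ms rule: rev_cases) (auto simp: M_def ks_def)
    show "\<forall>ms\<in>M. h (last ms, set (butlast ms)) = ms"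
    proof
      fix ms assume ms: "ms \<in> M"
      then obtain xs N where "ms = xs @ [N]" "length xs = m" using dec by blast
      thus "h (last ms, set (butlast ms)) = ms"
        using ms by (auto simp: h_def M_def sorted_wrt_append strict_sorted_iff sorted_list_of_set.idem_if_sorted_distinct)
    qed
    show "(\<lambda>ms. (last ms, set (butlast ms))) ` M \<subseteq> (SIGMA N:{1..}. esubsets m N)"
    proof (intro image_subsetI SigmaI)
      fix ms assume ms: "ms \<in> M"
      then obtain xs N where "ms = xs @ [N]" "length xs = m" using dec by blast
      moreover from this ms have "sorted_wrt (<) xs" by (simp add: M_def sorted_wrt_append)
      hence "card (set xs) = length xs" by (simp add: strict_sorted_iff distinct_card)
      ultimately show "last ms \<in> {1..}" "set (butlast ms) \<in> esubsets m (last ms)"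
        using ms by (auto simp: M_def esubsets_def sorted_wrt_append Suc_le_eq intro: Nat.gr0I)
    qed
  qed
  have t: "t (h (N, S)) = (\<Prod>j\<in>S. 1 / real j) * (1 / real N ^ (n + 2))" if S: "S \<in> esubsets m N" for N S
  proof -
    define xs where "xs = sorted_list_of_set S"
    have "finite S" using S finite_subset[OF _ finite_atLeastLessThan] by (auto simp: esubsets_def)
    hence xs: "length xs = m" "set xs = S" "distinct xs"
      using S by (auto simp: xs_def esubsets_def)
    have "t (h (N, S)) = (\<Prod>i<m. 1 / real (xs ! i)) * (1 / real N ^ (n + 2))"
      using xs(1) by (simp add: t_def ks_def h_def xs_def[symmetric] nth_append)
    also have "(\<Prod>i<m. 1 / real (xs ! i)) = (\<Prod>j\<in>S. 1 / real j)"
      using bij_betw_nth[OF xs(3), of "{..<m}" S] xs(1,2) by (intro prod.reindex_bij_betw) auto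
    finally show ?thesis .
  qed
  have esum: "((\<lambda>S. t (h (N, S))) has_sum esym m N / real N ^ (n + 2)) (esubsets m N)" for N
    using t by (intro has_sum_finiteI finite_esubsets) (simp add: esym_def sum_divide_distrib)
  \<comment> \<open>The triple sum is sampled at x = y = 1/2; for fixed m and n the weight
    2^(-(m+1)) 2^(-n) is then multiplied away.\<close>
  have "(\<lambda>(mn, N). gterm (1/2) (1/2::real) (N, mn)) summable_on (UNIV \<times> {1..})"
    using gterm_summable_real[of "1/2" "1/2"] summable_on_swap[of "gterm (1/2) (1/2::real)" "{1..}" "UNIV \<times> UNIV"] by simp
  hence "(\<lambda>N. gterm (1/2) (1/2::real) (N, m, n)) summable_on {1..}"
    using summable_on_SigmaD1[of "\<lambda>mn N. gterm (1/2) (1/2::real) (N, mn)" UNIV "\<lambda>_. {1..}" "(m, n)"] by simp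
  hence "(\<lambda>N. 2 ^ Suc m * 2 ^ n * gterm (1/2) (1/2::real) (N, m, n)) summable_on {1..}"
    by (rule summable_on_cmult_right)
  hence sum: "(\<lambda>N. esym m N / real N ^ (n + 2)) summable_on {1..}"
    by (simp add: gterm_def power_one_over field_simps)
  have "(\<lambda>p. t (h p)) summable_on (SIGMA N:{1..}. esubsets m N)"
  proof (rule summable_on_SigmaI[OF esum sum])
    show "0 \<le> t (h (N, S))" for N S by (auto simp: t_def intro!: prod_nonneg)
  qed
  then obtain I where I: "((\<lambda>p. t (h p)) has_sum I) (SIGMA N:{1..}. esubsets m N)"
    by (auto simp: summable_on_def)
  hence "(t has_sum I) M"
    using has_sum_reindex_bij_betw[OF bij, of t I] by simp
  hence "I = mzv ks"
    unfolding mzv_def t_def M_def by (simp add: infsumI)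
  with has_sum_SigmaD[OF I esum] show ?thesis by (simp add: ks_def)
qed

text \<open>This is the same triple sum with N summed innermost.\<close>

lemma mzv_generating_function:
  fixes x y :: complex
  assumes "norm x < 1" "norm y < 1"
  shows "((\<lambda>(m, n). of_real (mzv (replicate m 1 @ [n + 2])) * x ^ Suc m * y ^ n) has_sum Pfun x y 1) UNIV"
proof -
  have "((\<lambda>(mn, N). gterm x y (N, mn)) has_sum Pfun x y 1) (UNIV \<times> {1..})"
    using gterm_has_sum[OF assms] has_sum_swap[where f = "gterm x y" and A = "{1..}" and B = "UNIV \<times> UNIV"] by simp
  moreover have "((\<lambda>N. (\<lambda>(mn, N). gterm x y (N, mn)) (mn, N)) has_sum (\<lambda>(m, n). of_real (mzv (replicate m 1 @ [n + 2])) * x ^ Suc m * y ^ n) mn) {1..}" for mn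
  proof (cases mn)
    case (Pair m n)
    have "((\<lambda>N. of_real (esym m N / real N ^ (n + 2)) * (x ^ Suc m * y ^ n)) has_sum of_real (mzv (replicate m 1 @ [n + 2])) * (x ^ Suc m * y ^ n)) {1..}"
      by (intro has_sum_cmult_left has_sum_of_real mzv_has_sum)
    thus ?thesis by (simp add: Pair gterm_def mult_ac)
  qed
  ultimately show ?thesis by (rule has_sum_SigmaD)
qed

subsection \<open>Even zeta values\<close>

declare bernoulli.simps [simp del]

lemma small_not_nonpos_Ints:
  assumes "norm (z::complex) < 1" "z \<noteq> 0"
  shows "z \<notin> \<int>\<^sub>\<le>\<^sub>0" "1 - z \<notin> \<int>\<^sub>\<le>\<^sub>0"
proof -
  show "z \<notin> \<int>\<^sub>\<le>\<^sub>0"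
  proof
    assume "z \<in> \<int>\<^sub>\<le>\<^sub>0"
    then obtain n where "z = - of_nat n" by (elim nonpos_Ints_cases')
    thus False using assms by simp
  qed
  show "1 - z \<notin> \<int>\<^sub>\<le>\<^sub>0"
  proof
    assume "1 - z \<in> \<int>\<^sub>\<le>\<^sub>0"
    then obtain n where "1 - z = - of_nat n" by (elim nonpos_Ints_cases')
    hence "z = of_nat (Suc n)" by (simp add: algebra_simps)
    hence "norm z = real (Suc n)" by (metis norm_of_nat)
    thus False using assms by simp
  qed
qed

text \<open>If the sine vanished, the reflection formula would read pi / 0 = 0 on the right, whereas
  Gamma has no zeros away from its poles.\<close>

lemma sin_pi_nonzero:
  assumes "norm (z::complex) < 1" "z \<noteq> 0"
  shows "sin (of_real pi * z) \<noteq> 0"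
proof -
  have "Gamma z * Gamma (1 - z) \<noteq> 0"
    using small_not_nonpos_Ints[OF assms] by (simp add: Gamma_eq_zero_iff)
  thus ?thesis unfolding Gamma_reflection_complex by auto
qed

text \<open>The logarithmic derivative of the Gamma reflection formula.\<close>

lemma Digamma_reflection_complex:
  assumes "norm (z::complex) < 1" "z \<noteq> 0"
  shows "Digamma (1 - z) - Digamma z = of_real pi * cot (of_real pi * z)"
proof -
  define s where "s = sin (of_real pi * z)"
  have s: "s \<noteq> 0" using sin_pi_nonzero[OF assms] by (simp add: s_def)
  have "((\<lambda>z::complex. Gamma z * Gamma (1 - z)) has_field_derivative Gamma z * Gamma (1 - z) * (Digamma z - Digamma (1 - z))) (at z)"
    using small_not_nonpos_Ints[OF assms] by (auto intro!: derivative_eq_intros simp: algebra_simps)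
  moreover have "((\<lambda>z::complex. of_real pi / sin (of_real pi * z)) has_field_derivative
      - (of_real pi / s) * (of_real pi * cos (of_real pi * z) / s)) (at z)"
    using s unfolding s_def by (auto intro!: derivative_eq_intros simp: field_simps)
  ultimately have "of_real pi / s * (Digamma z - Digamma (1 - z)) = - (of_real pi / s) * (of_real pi * cos (of_real pi * z) / s)"
    unfolding Gamma_reflection_complex s_def[symmetric] by (rule DERIV_unique)
  hence "of_real pi / s * (Digamma z - Digamma (1 - z)) = of_real pi / s * (- (of_real pi * cos (of_real pi * z) / s))"
    by simp
  hence "Digamma z - Digamma (1 - z) = - (of_real pi * cos (of_real pi * z) / s)"
    unfolding mult_cancel_left using s by simp
  thus ?thesis by (simp add: cot_def s_def algebra_simps)
qed

text \<open>The Taylor expansion of the digamma function at 1. It is stated for \<open>y * H\<close>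
  rather than for \<open>H\<close> so that y = 0 is included.\<close>

lemma mzv_single_has_sum:
  assumes "norm (y::complex) < 1"
  obtains H where "((\<lambda>n. of_real (mzv [n + 2]) * y ^ n) has_sum H) UNIV" "y * H = - Digamma (1 - y) - euler_mascheroni"
proof -
  define f where "f = (\<lambda>(N, n). y ^ n / of_nat N ^ (n + 2))"
  \<comment> \<open>The slice m = 0 carries the weight x^1 = 1/2, which the factor 2 below
    removes.\<close>
  have "gterm (1/2) y summable_on ({1..} \<times> UNIV \<times> UNIV)"
    using gterm_has_sum[of "1/2" y] assms by (auto simp: summable_on_def)
  hence "gterm (1/2) y summable_on ((\<lambda>(N, n). (N, 0, n)) ` ({1..} \<times> UNIV))"
    by (rule summable_on_subset_banach) auto
  hence "(gterm (1/2) y \<circ> (\<lambda>(N, n). (N, 0, n))) summable_on ({1..} \<times> UNIV)"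
    by (subst (asm) summable_on_reindex) (auto simp: inj_on_def)
  hence "(\<lambda>p. 2 * (gterm (1/2) y \<circ> (\<lambda>(N, n). (N, 0, n))) p) summable_on ({1..} \<times> UNIV)"
    by (rule summable_on_cmult_right)
  also have "(\<lambda>p. 2 * (gterm (1/2) y \<circ> (\<lambda>(N, n). (N, 0, n))) p) = f"
    by (auto simp: fun_eq_iff gterm_def f_def esym_0)
  finally obtain H where H: "(f has_sum H) ({1..} \<times> UNIV)" by (auto simp: summable_on_def)
  have "((\<lambda>N. 1 / (of_nat N * (of_nat N - y))) has_sum H) {1..}"
    by (rule has_sum_SigmaD[OF H]) (unfold f_def prod.case, rule geometric_tail_has_sum[OF assms], simp)
  moreover have "bij_betw Suc UNIV {1..}"
    by (rule bij_betwI[of _ _ _ "\<lambda>n. n - 1"]) auto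
  ultimately have "((\<lambda>k. 1 / (of_nat (Suc k) * (of_nat (Suc k) - y))) has_sum H) UNIV"
    using has_sum_reindex_bij_betw[of Suc UNIV "{1..}" "\<lambda>N. 1 / (of_nat N * (of_nat N - y))" H] by simp
  hence "(\<lambda>k. - y * (1 / (of_nat (Suc k) * (of_nat (Suc k) - y)))) sums (- y * H)"
    by (intro sums_mult has_sum_imp_sums)
  moreover have "- y * (1 / (of_nat (Suc k) * (of_nat (Suc k) - y))) = inverse (of_nat (Suc k)) - inverse (1 - y + of_nat k)" for k
  proof -
    have nz: "of_nat (Suc k) - y \<noteq> 0" "of_nat (Suc k) \<noteq> (0::complex)"
      using of_nat_minus_nz[OF assms, of "Suc k"] by (auto simp del: of_nat_Suc)
    have "1 - y + of_nat k = of_nat (Suc k) - y" by simp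
    thus ?thesis using nz by (simp only:) (simp add: field_simps del: of_nat_Suc)
  qed
  ultimately have D: "Digamma (1 - y) = - y * H - euler_mascheroni"
    unfolding Digamma_def by (simp add: sums_iff)
  have "((\<lambda>(n, N). f (N, n)) has_sum H) (UNIV \<times> {1..})"
    using H has_sum_swap[where f = f and A = "{1..}" and B = UNIV] by simp
  hence "((\<lambda>n. of_real (mzv [n + 2]) * y ^ n) has_sum H) UNIV"
  proof (rule has_sum_SigmaD)
    fix n
    have "((\<lambda>N. of_real (esym 0 N / real N ^ (n + 2)) * y ^ n) has_sum of_real (mzv (replicate 0 1 @ [n + 2])) * y ^ n) {1..}"
      by (intro has_sum_cmult_left has_sum_of_real mzv_has_sum)
    thus "((\<lambda>N. (\<lambda>(n, N). f (N, n)) (n, N)) has_sum of_real (mzv [n + 2]) * y ^ n) {1..}"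
      by (simp add: esym_0 f_def)
  qed
  thus ?thesis by (rule that) (simp add: D)
qed

text \<open>The value at 0 is set separately: with cot 0 = 0 from division by zero, the formula
  would give 1/2.\<close>

definition zeta_even_sum :: "complex \<Rightarrow> complex"
  where "zeta_even_sum X = (if X = 0 then 0 else (1 - of_real pi * X * cot (of_real pi * X)) / 2)"

text \<open>Averaging the digamma expansion at X and - X removes the odd powers. The shift from 1 +
  X to X then makes the reflection formula applicable, and it produces the cotangent.\<close>

lemma zeta_even_has_sum:
  assumes "norm (X::complex) < 1"
  shows "((\<lambda>n. (if even n then of_real (mzv [n + 2]) else 0) * X ^ (n + 2)) has_sum zeta_even_sum X) UNIV"
proof (cases "X = 0")
  case True
  thus ?thesis by (auto simp: zeta_even_sum_def intro!: has_sum_0)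
next
  case False
  obtain H1 where H1: "((\<lambda>n. of_real (mzv [n + 2]) * X ^ n) has_sum H1) UNIV" "X * H1 = - Digamma (1 - X) - euler_mascheroni"
    using mzv_single_has_sum[OF assms] by blast
  obtain H2 where H2: "((\<lambda>n. of_real (mzv [n + 2]) * (- X) ^ n) has_sum H2) UNIV" "(- X) * H2 = - Digamma (1 + X) - euler_mascheroni"
    using mzv_single_has_sum[of "- X"] assms by (auto simp del: mult_minus_left)
  have "((\<lambda>n. (of_real (mzv [n + 2]) * X ^ n + of_real (mzv [n + 2]) * (- X) ^ n) * (X ^ 2 / 2)) has_sum (H1 + H2) * (X ^ 2 / 2)) UNIV"
    by (intro has_sum_cmult_left has_sum_add H1 H2)
  also have "(\<lambda>n. (of_real (mzv [n + 2]) * X ^ n + of_real (mzv [n + 2]) * (- X) ^ n) * (X ^ 2 / 2)) =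
      (\<lambda>n. (if even n then of_real (mzv [n + 2]) else 0) * X ^ (n + 2))"
    by (auto simp: fun_eq_iff power2_eq_square)
  also have "(H1 + H2) * (X ^ 2 / 2) = X / 2 * (X * H1 - (- X) * H2)"
    by (simp add: power2_eq_square algebra_simps)
  also have "Digamma (X + 1) = Digamma X + 1 / X"
    using False by (rule Digamma_plus1)
  hence "X / 2 * (X * H1 - (- X) * H2) = X / 2 * (1 / X - (Digamma (1 - X) - Digamma X))"
    unfolding H1 H2 by (simp add: add.commute)
  also have "\<dots> = zeta_even_sum X"
    unfolding Digamma_reflection_complex[OF assms False] zeta_even_sum_def using False by (simp add: field_simps)
  finally show ?thesis .
qed

section \<open>Comparison with the Bernoulli generating function\<close>

lemma has_fps_expansion_if_sums:
  fixes f :: "complex \<Rightarrow> complex"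
  assumes "\<And>z. norm z < 1 \<Longrightarrow> (\<lambda>n. a n * z ^ n) sums f z"
  shows "f has_fps_expansion Abs_fps a"
  unfolding has_fps_expansion_def
proof
  have "summable (\<lambda>n. a n * (1/2) ^ n)" using assms[of "1/2"] by (auto simp: sums_iff)
  hence "conv_radius a \<ge> norm (1/2 :: complex)" by (rule conv_radius_geI)
  moreover have "ereal (norm (1/2 :: complex)) > 0" by simp
  ultimately have "conv_radius a > 0" by (rule less_le_trans[rotated])
  thus "fps_conv_radius (Abs_fps a) > 0" by (simp add: fps_conv_radius_def)
  have "eventually (\<lambda>z. z \<in> ball 0 1) (nhds (0::complex))"
    by (rule eventually_nhds_in_open) auto
  thus "eventually (\<lambda>z. eval_fps (Abs_fps a) z = f z) (nhds 0)"
    by eventually_elim (use assms in \<open>auto simp: eval_fps_def sums_iff\<close>)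
qed

lemma bernoulli_sum_zero:
  assumes "n \<noteq> 0"
  shows "(\<Sum>j\<le>n. real (Suc n choose j) * bernoulli j) = 0"
proof -
  have "real (Suc n) * bernoulli n = - (\<Sum>j<n. real (Suc n choose j) * bernoulli j)"
    using assms by (subst bernoulli.simps) (simp del: of_nat_Suc binomial_Suc_Suc)
  thus ?thesis
    by (simp add: lessThan_Suc_atMost[symmetric] del: of_nat_Suc binomial_Suc_Suc)
qed

text \<open>Up to c^(m+1) / (m+1)!, the coefficient of index m + 1 is the sum in the Bernoulli
  recurrence. The identity stays in product form because \<open>fps_exp c - 1\<close> has constant
  term 0 and is not invertible.\<close>

lemma fps_exp_bernoulli:
  fixes c :: complex
  shows "(fps_exp c - 1) * Abs_fps (\<lambda>n. of_real (bernoulli n) * c ^ n / fact n) = fps_const c * fps_X"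
proof (rule fps_ext)
  fix n
  let ?B = "Abs_fps (\<lambda>n. of_real (bernoulli n) * c ^ n / fact n)"
  show "((fps_exp c - 1) * ?B) $ n = (fps_const c * fps_X) $ n"
  proof (cases n)
    case 0
    thus ?thesis by simp
  next
    case (Suc m)
    have "((fps_exp c - 1) * ?B) $ n = (\<Sum>j\<le>Suc m. ?B $ j * (fps_exp c - 1) $ (Suc m - j))"
      unfolding mult.commute[of _ ?B] fps_mult_nth Suc atLeast0AtMost ..
    also have "\<dots> = (\<Sum>j\<le>m. ?B $ j * (fps_exp c - 1) $ (Suc m - j))"
      unfolding sum.atMost_Suc by simp
    also have "\<dots> = (\<Sum>j\<le>m. of_real (real (Suc m choose j) * bernoulli j) * (c ^ Suc m / fact (Suc m)))"
    proof (intro sum.cong refl)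
      fix j assume j: "j \<in> {..m}"
      hence "of_nat (Suc m choose j) = (fact (Suc m) / (fact j * fact (Suc m - j)) :: complex)"
        by (intro binomial_fact) auto
      moreover have "c ^ Suc m = c ^ j * c ^ (Suc m - j)"
        using j by (simp flip: power_add)
      ultimately show "?B $ j * (fps_exp c - 1) $ (Suc m - j) = of_real (real (Suc m choose j) * bernoulli j) * (c ^ Suc m / fact (Suc m))"
        using j by (simp add: field_simps del: power_Suc fact_Suc binomial_Suc_Suc)
    qed
    also have "\<dots> = of_real (\<Sum>j\<le>m. real (Suc m choose j) * bernoulli j) * (c ^ Suc m / fact (Suc m))"
      unfolding of_real_sum sum_distrib_right ..
    also have "\<dots> = (fps_const c * fps_X) $ n"
      using bernoulli_sum_zero[of m] by (cases "m = 0") (simp_all add: Suc bernoulli.simps[of 0] del: binomial_Suc_Suc)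
    finally show ?thesis .
  qed
qed

text \<open>With c = 2 pi i one has pi X cot(pi X) = c X / 2 + c X / (exp(c X) - 1), so the even
  zeta values are, up to the factor -2, coefficients of the Bernoulli generating function.\<close>

lemma mzv_even_bernoulli_complex:
  assumes "k \<ge> 1"
  shows "- 2 * of_real (mzv [2 * k]) = of_real (bernoulli (2 * k)) * (2 * \<i> * of_real pi) ^ (2 * k) / fact (2 * k)"
proof -
  define c where "c = 2 * \<i> * of_real pi"
  have c: "c \<noteq> 0" by (simp add: c_def)
  define a where "a = (\<lambda>n. if even n \<and> n \<ge> 2 then of_real (mzv [n]) else 0 :: complex)"
  \<comment> \<open>This is c X / (exp(c X) - 1), with value 1 at 0. The linear term accounts for
    the Bernoulli number -1/2 of index 1, which the cotangent lacks.\<close>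
  define C where "C = (\<lambda>X. 1 - c / 2 * X - 2 * zeta_even_sum X)"
  have "(\<lambda>n. a n * z ^ n) sums zeta_even_sum z" if "norm z < 1" for z
  proof -
    have "(\<lambda>n. a (n + 2) * z ^ (n + 2)) sums zeta_even_sum z"
    proof -
      have "a (n + 2) = (if even n then of_real (mzv [n + 2]) else 0)" for n
        by (simp add: a_def)
      thus ?thesis using has_sum_imp_sums[OF zeta_even_has_sum[OF that]] by (simp only:)
    qed
    hence "(\<lambda>n. a n * z ^ n) sums (zeta_even_sum z + (\<Sum>i<2. a i * z ^ i))"
      by (subst (asm) sums_iff_shift)
    thus ?thesis by (simp add: a_def numeral_2_eq_2)
  qed
  hence "zeta_even_sum has_fps_expansion Abs_fps a"
    by (rule has_fps_expansion_if_sums)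
  hence C: "C has_fps_expansion (1 - fps_const (c / 2) * fps_X - fps_const 2 * Abs_fps a)" (is "_ has_fps_expansion ?C")
    unfolding C_def by (intro fps_expansion_intros)
  have "(\<lambda>X. (exp (c * X) - 1) * C X) has_fps_expansion (fps_exp c - 1) * ?C"
    by (intro fps_expansion_intros C)
  moreover have "(\<lambda>X. (exp (c * X) - 1) * C X) has_fps_expansion fps_const c * fps_X"
  proof -
    have "eventually (\<lambda>z. z \<in> ball 0 1) (nhds (0::complex))"
      by (rule eventually_nhds_in_open) auto
    hence ev: "eventually (\<lambda>X. c * X = (exp (c * X) - 1) * C X) (nhds 0)"
    proof eventually_elim
      case (elim X)
      show ?case
      proof (cases "X = 0")
        case False
        define e where "e = exp (\<i> * (of_real pi * X))"
        have e0: "e \<noteq> 0" by (simp add: e_def)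
        have "c * X = \<i> * (of_real pi * X) + \<i> * (of_real pi * X)"
          by (simp add: c_def)
        hence e: "exp (c * X) = e * e" "exp (- (\<i> * (of_real pi * X))) = 1 / e"
          unfolding e_def by (simp_all only: exp_add) (simp add: exp_minus divide_inverse)
        have s: "sin (of_real pi * X) = (e - 1 / e) / (2 * \<i>)" and co: "cos (of_real pi * X) = (e + 1 / e) / 2"
          by (simp_all add: sin_exp_eq cos_exp_eq e e_def[symmetric])
        have "sin (of_real pi * X) \<noteq> 0" using sin_pi_nonzero[of X] elim False by simp
        hence nz: "e * e - 1 \<noteq> 0" using e0 unfolding s by (auto simp: field_simps)
        have "C X = of_real pi * X * cot (of_real pi * X) - c / 2 * X"
          using False by (simp add: C_def zeta_even_sum_def diff_divide_distrib)
        also have "cot (of_real pi * X) = \<i> * (e * e + 1) / (e * e - 1)"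
          unfolding cot_def s co using e0 nz by (simp add: field_simps)
        also have "(e * e - 1) * (of_real pi * X * (\<i> * (e * e + 1) / (e * e - 1)) - c / 2 * X) = c * X"
          using nz by (simp add: c_def field_simps)
        finally show ?thesis unfolding e by simp
      qed simp
    qed
    have "(\<lambda>X. c * X) has_fps_expansion fps_const c * fps_X"
      by (intro fps_expansion_intros)
    thus ?thesis
      by (rule has_fps_expansion_cong[OF ev refl, THEN iffD1])
  qed
  ultimately have "(fps_exp c - 1) * ?C = fps_const c * fps_X"
    by (rule fps_expansion_unique_complex)
  hence "(fps_exp c - 1) * ?C = (fps_exp c - 1) * Abs_fps (\<lambda>n. of_real (bernoulli n) * c ^ n / fact n)"
    unfolding fps_exp_bernoulli .
  \<comment> \<open>Formal power series form an integral domain, so a nonzero factor can be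
    cancelled although it is not a unit.\<close>
  moreover have "fps_exp c - 1 \<noteq> 0"
  proof
    assume "fps_exp c - 1 = 0"
    hence "(fps_exp c - 1) $ 1 = 0" by simp
    thus False using c by simp
  qed
  ultimately have "?C = Abs_fps (\<lambda>n. of_real (bernoulli n) * c ^ n / fact n)"
    by simp
  hence "?C $ (2 * k) = of_real (bernoulli (2 * k)) * c ^ (2 * k) / fact (2 * k)"
    by simp
  thus ?thesis using assms by (simp add: a_def c_def)
qed

lemma even_power_i: "(\<i> * z) ^ (2 * k) = (- 1) ^ k * z ^ (2 * k)"
  by (subst power_mult_distrib) (simp add: power_mult)

text \<open>The coefficient of X^(2k) in pi X cot(pi X), from which the tangent and cosecant
  coefficients are both assembled.\<close>

definition beta :: "nat \<Rightarrow> real"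
  where "beta k = (-1) ^ k * bernoulli (2 * k) * (2 * pi) ^ (2 * k) / fact (2 * k)"

lemma beta_0: "beta 0 = 1" by (simp add: beta_def bernoulli.simps[of 0])

lemma beta_eq:
  assumes "k \<ge> 1"
  shows "beta k = - 2 * mzv [2 * k]"
proof -
  have "complex_of_real (- 2 * mzv [2 * k]) = - 2 * of_real (mzv [2 * k])" by simp
  also have "\<dots> = of_real (bernoulli (2 * k)) * (\<i> * (2 * of_real pi)) ^ (2 * k) / fact (2 * k)"
    unfolding mzv_even_bernoulli_complex[OF assms] by (simp only: mult_ac)
  also have "\<dots> = of_real (beta k)"
    unfolding even_power_i beta_def by (simp add: mult_ac)
  finally show ?thesis by (metis of_real_eq_iff)
qed

lemma mzv_even_bernoulli:
  assumes "k \<ge> 1"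
  shows "mzv [2 * k] = (-1) ^ (k + 1) * (2 * pi) ^ (2 * k) * bernoulli (2 * k) / (2 * fact (2 * k))"
  using beta_eq[OF assms] by (simp add: beta_def field_simps)

lemma zeta_even_sums:
  assumes "norm (X::complex) < 1"
  shows "(\<lambda>k. of_real (mzv [2 * Suc k]) * X ^ (2 * Suc k)) sums zeta_even_sum X"
proof -
  let ?f = "\<lambda>n. (if even n then of_real (mzv [n + 2]) else 0) * X ^ (n + 2)"
  have "(?f has_sum zeta_even_sum X) (range (\<lambda>k. 2 * k))"
    by (rule has_sum_cong_neutral[THEN iffD1, OF _ _ _ zeta_even_has_sum[OF assms]])
       (auto elim!: evenE)
  hence "((?f \<circ> (\<lambda>k. 2 * k)) has_sum zeta_even_sum X) UNIV"
    by (subst (asm) has_sum_reindex) (auto simp: inj_on_def)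
  from has_sum_imp_sums[OF this] show ?thesis by (simp add: o_def)
qed

lemma beta_sums:
  assumes "norm (X::complex) < 1" "X \<noteq> 0"
  shows "(\<lambda>k. of_real (beta k) * X ^ (2 * k)) sums (of_real pi * X * cot (of_real pi * X))"
proof -
  have "(\<lambda>k. - 2 * (of_real (mzv [2 * Suc k]) * X ^ (2 * Suc k))) sums (- 2 * zeta_even_sum X)"
    by (intro sums_mult zeta_even_sums assms)
  also have "(\<lambda>k. - 2 * (of_real (mzv [2 * Suc k]) * X ^ (2 * Suc k))) = (\<lambda>k. of_real (beta (Suc k)) * X ^ (2 * Suc k))"
    by (simp add: beta_eq mult.assoc)
  finally have "(\<lambda>k. of_real (beta k) * X ^ (2 * k)) sums (- 2 * zeta_even_sum X + of_real (beta 0) * X ^ (2 * 0))"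
    by (rule sums_Suc)
  also have "- 2 * zeta_even_sum X + of_real (beta 0) * X ^ (2 * 0) = of_real pi * X * cot (of_real pi * X)"
    using assms by (simp add: zeta_even_sum_def beta_0 field_simps)
  finally show ?thesis .
qed

subsection \<open>The generating series of the theorem\<close>

text \<open>A power series in X^2 that converges at some r with |X| < r < 1 converges absolutely at
  X. The origin is excluded in the assumption because the closed forms with cot and csc hold only
  for X \<noteq> 0.\<close>

lemma summable_norm_even_powers:
  fixes X :: complex
  assumes "\<And>X. norm X < 1 \<Longrightarrow> X \<noteq> 0 \<Longrightarrow> summable (\<lambda>k. a k * X ^ (2 * k))" "norm X < 1"
  shows "summable (\<lambda>k. norm (a k * X ^ (2 * k)))"
proof -
  obtain r where r: "norm X < r" "r < 1" using assms(2) dense by blast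
  have "0 < r" using r(1) norm_ge_zero[of X] by linarith
  hence "summable (\<lambda>k. a k * (of_real r ^ 2) ^ k)"
    using assms(1)[of "of_real r"] r by (simp add: power_mult)
  moreover have "norm (X ^ 2) < norm ((of_real r :: complex) ^ 2)"
    using r \<open>0 < r\<close> by (simp add: norm_power power_strict_mono)
  ultimately have "summable (\<lambda>k. norm (a k * (X ^ 2) ^ k))"
    by (rule powser_insidea)
  thus ?thesis by (simp add: power_mult)
qed

text \<open>The coefficients of (pi X / 2) tan(pi X / 2); those of \<open>csc_coeff\<close> belong
  to pi X / sin(pi X).\<close>

definition tan_coeff :: "nat \<Rightarrow> real"
  where "tan_coeff u = (-1) ^ u * (1 - 2 ^ (2*u)) * bernoulli (2*u) * pi ^ (2*u) / fact (2*u)"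

definition csc_coeff :: "nat \<Rightarrow> real"
  where "csc_coeff u = (-1) ^ u * (2 - 2 ^ (2*u)) * bernoulli (2*u) * pi ^ (2*u) / fact (2*u)"

text \<open>On coefficients these are h tan h = h cot h - 2 h cot(2 h) and z / sin z = z cot(z / 2)
  - z cot z; dividing by 2^(2u) passes from X to X / 2.\<close>

lemma coeff_beta: "tan_coeff u = beta u / 2 ^ (2*u) - beta u" "csc_coeff u = 2 * (beta u / 2 ^ (2*u)) - beta u"
  by (simp_all add: tan_coeff_def csc_coeff_def beta_def power_mult_distrib field_simps)

text \<open>The cotangent at half the angle is written over sin(pi X) so that all three series share
  this denominator.\<close>

lemma beta_half_sums:
  assumes "norm (X::complex) < 1" "X \<noteq> 0"
  shows "(\<lambda>u. of_real (beta u / 2 ^ (2*u)) * X ^ (2*u)) sums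
     (of_real pi * X / 2 * ((1 + cos (of_real pi * X)) / sin (of_real pi * X)))"
proof -
  have X: "norm (X / 2) < 1" "X / 2 \<noteq> 0" using assms by (auto simp: norm_divide)
  define h where "h = of_real pi * (X / 2)"
  have h: "sin h \<noteq> 0" using sin_pi_nonzero[OF X] by (simp add: h_def)
  have z: "of_real pi * X = 2 * h" by (simp add: h_def)
  have "sin (2 * h) \<noteq> 0" using sin_pi_nonzero[OF assms] z by simp
  hence ch: "cos h \<noteq> 0" by (auto simp: sin_double)
  have "cot h = (1 + cos (2 * h)) / sin (2 * h)"
  proof -
    have "1 + cos (2 * h) = 2 * cos h * cos h" "sin (2 * h) = 2 * sin h * cos h"
      by (simp_all add: cos_double_cos sin_double power2_eq_square)
    thus ?thesis using h ch by (simp add: cot_def)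
  qed
  moreover have "(\<lambda>u. of_real (beta u) * (X / 2) ^ (2*u)) sums (of_real pi * (X / 2) * cot h)"
    using beta_sums[OF X] by (simp only: h_def)
  ultimately show ?thesis
    unfolding z by (simp add: power_divide h_def)
qed

lemma tan_coeff_sums:
  assumes "norm (X::complex) < 1" "X \<noteq> 0"
  shows "(\<lambda>u. of_real (tan_coeff u) * X ^ (2*u)) sums
     (of_real pi * X / 2 * ((1 - cos (of_real pi * X)) / sin (of_real pi * X)))"
proof -
  have "(\<lambda>u. of_real (beta u / 2 ^ (2*u)) * X ^ (2*u) - of_real (beta u) * X ^ (2*u)) sums
     (of_real pi * X / 2 * ((1 + cos (of_real pi * X)) / sin (of_real pi * X)) - of_real pi * X * cot (of_real pi * X))"
    by (intro sums_diff beta_half_sums beta_sums assms)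
  also have "of_real pi * X / 2 * ((1 + cos (of_real pi * X)) / sin (of_real pi * X)) - of_real pi * X * cot (of_real pi * X)
    = of_real pi * X / 2 * ((1 - cos (of_real pi * X)) / sin (of_real pi * X))"
    using sin_pi_nonzero[OF assms] by (simp add: cot_def field_simps)
  finally show ?thesis by (simp only: coeff_beta of_real_diff left_diff_distrib)
qed

lemma csc_coeff_sums:
  assumes "norm (X::complex) < 1" "X \<noteq> 0"
  shows "(\<lambda>u. of_real (csc_coeff u) * X ^ (2*u)) sums (of_real pi * X / sin (of_real pi * X))"
proof -
  have "(\<lambda>u. 2 * (of_real (beta u / 2 ^ (2*u)) * X ^ (2*u)) - of_real (beta u) * X ^ (2*u)) sums
     (2 * (of_real pi * X / 2 * ((1 + cos (of_real pi * X)) / sin (of_real pi * X))) - of_real pi * X * cot (of_real pi * X))"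
    by (intro sums_diff sums_mult beta_half_sums beta_sums assms)
  also have "2 * (of_real pi * X / 2 * ((1 + cos (of_real pi * X)) / sin (of_real pi * X))) - of_real pi * X * cot (of_real pi * X)
    = of_real pi * X / sin (of_real pi * X)"
    using sin_pi_nonzero[OF assms] by (simp add: cot_def field_simps)
  also have "(\<lambda>u. 2 * (of_real (beta u / 2 ^ (2*u)) * X ^ (2*u)) - of_real (beta u) * X ^ (2*u)) = (\<lambda>u. of_real (csc_coeff u) * X ^ (2*u))"
    by (simp add: coeff_beta left_diff_distrib mult.assoc)
  finally show ?thesis .
qed

text \<open>The case j = 0 is needed: truncated subtraction would otherwise make the constant
  coefficient zeta(2) instead of 0.\<close>

definition wcoeff :: "nat \<Rightarrow> real"
  where "wcoeff j = (if j = 0 then 0 else mzv (replicate (2 * j - 1) 1 @ [2]))"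

text \<open>The summand v = 0 is \<open>wcoeff j\<close>. The inner sum of the theorem starts at v =
  1 and is therefore \<open>kcoeff j - wcoeff j\<close>.\<close>

definition kcoeff :: "nat \<Rightarrow> real"
  where "kcoeff j = (\<Sum>v<j. mzv (replicate (2 * (j - v) - 1) 1 @ [2 * v + 2]))"

lemma Wfun_sums:
  assumes "norm (X::complex) < 1"
  shows "(\<lambda>j. of_real (wcoeff j) * X ^ (2 * j)) sums Wfun X"
proof -
  have P: "((\<lambda>m. of_real (mzv (replicate m 1 @ [2])) * x ^ Suc m) has_sum Pfun x 0 1) UNIV" if "norm x < 1" for x :: complex
  proof -
    \<comment> \<open>With y = 0 and 0^0 = 1 only the terms with n = 0 survive.\<close>
    let ?f = "\<lambda>(m, n). of_real (mzv (replicate m 1 @ [n + 2])) * x ^ Suc m * 0 ^ n"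
    have "(?f has_sum Pfun x 0 1) (range (\<lambda>m. (m, 0)))"
      using that by (intro has_sum_cong_neutral[THEN iffD1, OF _ _ _ mzv_generating_function]) auto
    hence "((?f \<circ> (\<lambda>m. (m, 0))) has_sum Pfun x 0 1) UNIV"
      by (subst (asm) has_sum_reindex) (auto simp: inj_on_def)
    thus ?thesis by (simp add: o_def numeral_2_eq_2)
  qed
  let ?g = "\<lambda>m. (of_real (mzv (replicate m 1 @ [2])) * X ^ Suc m + of_real (mzv (replicate m 1 @ [2])) * (- X) ^ Suc m) / 2"
  have g: "(?g has_sum Wfun X) UNIV"
    unfolding Wfun_def using assms by (intro has_sum_divide_const has_sum_add P) auto
  have "(?g has_sum Wfun X) (range (\<lambda>p. Suc (2 * p)))"
  proof (rule has_sum_cong_neutral[THEN iffD1, OF _ _ _ g])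
    fix m assume "m \<in> UNIV - range (\<lambda>p. Suc (2 * p))"
    hence "even m" by (metis DiffD2 Suc_eq_plus1 oddE rangeI)
    thus "?g m = 0" by simp
  qed auto
  hence "((?g \<circ> (\<lambda>p. Suc (2 * p))) has_sum Wfun X) UNIV"
    by (subst (asm) has_sum_reindex) (auto simp: inj_on_def)
  hence "(?g \<circ> (\<lambda>p. Suc (2 * p))) sums Wfun X"
    by (rule has_sum_imp_sums)
  hence "(\<lambda>j. of_real (wcoeff (Suc j)) * X ^ (2 * Suc j)) sums Wfun X"
    by (simp add: o_def wcoeff_def mult_ac)
  hence "(\<lambda>j. of_real (wcoeff j) * X ^ (2 * j)) sums (Wfun X + of_real (wcoeff 0) * X ^ (2 * 0))"
    by (rule sums_Suc)
  thus ?thesis by (simp add: wcoeff_def)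
qed

text \<open>Averaging over the four signs keeps exactly the terms with odd m and even n.\<close>

lemma Kfun_sums:
  assumes "norm (X::complex) < 1"
  shows "(\<lambda>j. of_real (kcoeff j) * X ^ (2 * j)) sums Kfun X"
proof -
  define z where "z = (\<lambda>m n. complex_of_real (mzv (replicate m 1 @ [n + 2])))"
  have P: "((\<lambda>(m, n). z m n * x ^ Suc m * y ^ n) has_sum Pfun x y 1) UNIV" if "norm x < 1" "norm y < 1" for x y
    using mzv_generating_function[OF that] by (simp add: z_def)
  let ?f = "\<lambda>(m, n). if odd m \<and> even n then z m n * X ^ (Suc m + n) else 0"
  have "((\<lambda>p. ((\<lambda>(m, n). z m n * X ^ Suc m * X ^ n) p + (\<lambda>(m, n). z m n * (- X) ^ Suc m * X ^ n) p +
      (\<lambda>(m, n). z m n * X ^ Suc m * (- X) ^ n) p + (\<lambda>(m, n). z m n * (- X) ^ Suc m * (- X) ^ n) p) / 4) has_sum Kfun X) UNIV"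
    unfolding Kfun_def using assms by (intro has_sum_divide_const has_sum_add P) auto
  also have "(\<lambda>p. ((\<lambda>(m, n). z m n * X ^ Suc m * X ^ n) p + (\<lambda>(m, n). z m n * (- X) ^ Suc m * X ^ n) p +
      (\<lambda>(m, n). z m n * X ^ Suc m * (- X) ^ n) p + (\<lambda>(m, n). z m n * (- X) ^ Suc m * (- X) ^ n) p) / 4) = ?f"
    by (auto simp: fun_eq_iff power_add)
  finally have f: "(?f has_sum Kfun X) UNIV" .
  have "(?f has_sum Kfun X) (range (\<lambda>(p, v). (Suc (2 * p), 2 * v)))"
  proof (rule has_sum_cong_neutral[THEN iffD1, OF _ _ _ f])
    fix q :: "nat \<times> nat" assume "q \<in> UNIV - range (\<lambda>(p, v). (Suc (2 * p), 2 * v))"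
    thus "?f q = 0" by (cases q) (force elim!: oddE evenE)
  qed auto
  hence "((?f \<circ> (\<lambda>(p, v). (Suc (2 * p), 2 * v))) has_sum Kfun X) UNIV"
    by (subst (asm) has_sum_reindex) (auto simp: inj_on_def)
  \<comment> \<open>Grouping by s = p + v: with m = 2 p + 1 and n = 2 v the exponent m + n + 1
    equals 2 (s + 1).\<close>
  moreover have "bij_betw (\<lambda>(s, v). (s - v, v)) (SIGMA s:UNIV. {..s}) (UNIV :: (nat \<times> nat) set)"
    by (rule bij_betwI[of _ _ _ "\<lambda>(p, v). (p + v, v)"]) auto
  ultimately have "((\<lambda>q. (?f \<circ> (\<lambda>(p, v). (Suc (2 * p), 2 * v))) ((\<lambda>(s, v). (s - v, v)) q)) has_sum Kfun X) (SIGMA s:UNIV. {..s})"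
    by (simp only: has_sum_reindex_bij_betw)
  hence "((\<lambda>s. of_real (kcoeff (Suc s)) * X ^ (2 * Suc s)) has_sum Kfun X) UNIV"
  proof (rule has_sum_SigmaD)
    fix s
    have q: "(?f \<circ> (\<lambda>(p, v). (Suc (2 * p), 2 * v))) ((\<lambda>(s, v). (s - v, v)) (s, v)) =
       of_real (mzv (replicate (2 * (Suc s - v) - 1) 1 @ [2 * v + 2])) * X ^ (2 * Suc s)" if "v \<le> s" for v
    proof -
      have "Suc (Suc (2 * (s - v))) + 2 * v = 2 * Suc s" "2 * (Suc s - v) - 1 = Suc (2 * (s - v))" using that by auto
      thus ?thesis by (simp add: z_def del: power_Suc)
    qed
    have "of_real (kcoeff (Suc s)) * X ^ (2 * Suc s) = (\<Sum>v\<le>s. (?f \<circ> (\<lambda>(p, v). (Suc (2 * p), 2 * v))) ((\<lambda>(s, v). (s - v, v)) (s, v)))"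
      unfolding kcoeff_def lessThan_Suc_atMost of_real_sum sum_distrib_right by (intro sum.cong[OF refl], subst q) auto
    thus "((\<lambda>v. (?f \<circ> (\<lambda>(p, v). (Suc (2 * p), 2 * v))) ((\<lambda>(s, v). (s - v, v)) (s, v))) has_sum of_real (kcoeff (Suc s)) * X ^ (2 * Suc s)) {..s}"
      by (intro has_sum_finiteI) auto
  qed
  hence "(\<lambda>j. of_real (kcoeff (Suc j)) * X ^ (2 * Suc j)) sums Kfun X"
    by (rule has_sum_imp_sums)
  hence "(\<lambda>j. of_real (kcoeff j) * X ^ (2 * j)) sums (Kfun X + of_real (kcoeff 0) * X ^ (2 * 0))"
    by (rule sums_Suc)
  thus ?thesis by (simp add: kcoeff_def)
qed

text \<open>The restricted ranges can be filled up to full convolutions because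
  \<open>tan_coeff 0\<close> and \<open>wcoeff 0\<close> vanish and
  \<open>kcoeff j = wcoeff j\<close> for j \<le> 1.\<close>

lemma coeff4p2_eq:
  assumes "k \<ge> 1"
  shows "coeff4p2 k = of_real (pi * mzv [2 * k]) - 2 * \<i> * (\<Sum>u\<le>k. of_real (tan_coeff u) * of_real (wcoeff (k - u)))
     - \<i> * (\<Sum>u\<le>k. of_real (csc_coeff u) * of_real (kcoeff (k - u) - wcoeff (k - u)))"
proof -
  have "(\<Sum>u\<le>k. complex_of_real (tan_coeff u) * of_real (wcoeff (k - u))) =
     (\<Sum>u=1..k-1. of_real (tan_coeff u) * of_real (wcoeff (k - u)))"
  proof (rule sum.mono_neutral_right)
    show "\<forall>i\<in>{..k} - {1..k - 1}. complex_of_real (tan_coeff i) * of_real (wcoeff (k - i)) = 0"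
    proof
      fix i assume "i \<in> {..k} - {1..k - 1}"
      hence "i = 0 \<or> i = k" by auto
      thus "complex_of_real (tan_coeff i) * of_real (wcoeff (k - i)) = 0"
        by (auto simp: tan_coeff_def wcoeff_def)
    qed
  qed auto
  also have "\<dots> = (\<Sum>u=1..k-1. of_real ((-1) ^ u * (1 - 2 ^ (2*u)) * bernoulli (2*u) * pi ^ (2*u)
                                     / fact (2*u) * mzv (replicate (2*(k-u) - 1) 1 @ [2])))"
    by (intro sum.cong refl) (auto simp: tan_coeff_def wcoeff_def)
  finally have 1: "(\<Sum>u\<le>k. complex_of_real (tan_coeff u) * of_real (wcoeff (k - u))) = \<dots>" .
  have diff: "kcoeff j - wcoeff j = (\<Sum>v=1..j-1. mzv (replicate (2*(j - v) - 1) 1 @ [2 * v + 2]))" for j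
  proof (cases j)
    case (Suc i)
    have "{..<Suc i} = insert 0 {1..i}" by auto
    thus ?thesis by (simp add: Suc kcoeff_def wcoeff_def numeral_2_eq_2)
  qed (simp add: kcoeff_def wcoeff_def)
  have "(\<Sum>u\<le>k. complex_of_real (csc_coeff u) * of_real (kcoeff (k - u) - wcoeff (k - u))) =
     (\<Sum>u<k-1. of_real (csc_coeff u) * of_real (kcoeff (k - u) - wcoeff (k - u)))"
  proof (rule sum.mono_neutral_right)
    show "\<forall>i\<in>{..k} - {..<k - 1}. complex_of_real (csc_coeff i) * of_real (kcoeff (k - i) - wcoeff (k - i)) = 0"
    proof
      fix i assume "i \<in> {..k} - {..<k - 1}"
      hence "k - i - 1 = 0" by auto
      thus "complex_of_real (csc_coeff i) * of_real (kcoeff (k - i) - wcoeff (k - i)) = 0"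
        by (simp add: diff)
    qed
  qed auto
  also have "\<dots> = (\<Sum>u<k-1. of_real ((-1) ^ u * (2 - 2 ^ (2*u)) * bernoulli (2*u) * pi ^ (2*u) / fact (2*u)
                 * (\<Sum>v=1..k-u-1. mzv (replicate (2*(k - v - u) - 1) 1 @ [(2 * v + 2)]))))"
  proof (intro sum.cong refl)
    fix u
    have "k - u - v = k - v - u" for v by simp
    thus "of_real (csc_coeff u) * of_real (kcoeff (k - u) - wcoeff (k - u)) = complex_of_real ((-1) ^ u * (2 - 2 ^ (2*u)) * bernoulli (2*u) * pi ^ (2*u) / fact (2*u)
                 * (\<Sum>v=1..k-u-1. mzv (replicate (2*(k - v - u) - 1) 1 @ [(2 * v + 2)])))"
      unfolding diff csc_coeff_def of_real_mult[symmetric] by (simp only:)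
  qed
  finally have 2: "(\<Sum>u\<le>k. complex_of_real (csc_coeff u) * of_real (kcoeff (k - u) - wcoeff (k - u))) = \<dots>" .
  show ?thesis unfolding coeff4p2_def 1 2 ..
qed

lemma even_Cauchy_product_sums:
  fixes a b :: "nat \<Rightarrow> real" and A B :: "complex \<Rightarrow> complex"
  assumes "\<And>X. norm X < 1 \<Longrightarrow> X \<noteq> 0 \<Longrightarrow> (\<lambda>k. of_real (a k) * X ^ (2 * k)) sums A X"
    and "\<And>X. norm X < 1 \<Longrightarrow> X \<noteq> 0 \<Longrightarrow> (\<lambda>k. of_real (b k) * X ^ (2 * k)) sums B X"
    and X: "norm X < 1" "X \<noteq> 0"
  shows "(\<lambda>k. (\<Sum>u\<le>k. of_real (a u) * of_real (b (k - u))) * X ^ (2 * k)) sums (A X * B X)"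
proof -
  have "summable (\<lambda>k. norm (complex_of_real (a k) * X ^ (2 * k)))" "summable (\<lambda>k. norm (complex_of_real (b k) * X ^ (2 * k)))"
    by (rule summable_norm_even_powers[OF sums_summable[OF assms(1)] X(1)]
             summable_norm_even_powers[OF sums_summable[OF assms(2)] X(1)]; assumption)+
  from Cauchy_product_sums[OF this]
  have "(\<lambda>k. \<Sum>i\<le>k. of_real (a i) * X ^ (2 * i) * (of_real (b (k - i)) * X ^ (2 * (k - i)))) sums (A X * B X)"
    using sums_unique[OF assms(1)[OF X]] sums_unique[OF assms(2)[OF X]] by simp
  moreover have "of_real (a i) * X ^ (2 * i) * (of_real (b (k - i)) * X ^ (2 * (k - i))) = of_real (a i) * of_real (b (k - i)) * X ^ (2 * k)"
    if "i \<in> {..k}" for i k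
  proof -
    have "X ^ (2 * k) = X ^ (2 * i) * X ^ (2 * (k - i))" using that by (simp flip: power_add add: algebra_simps)
    thus ?thesis by simp
  qed
  hence "(\<Sum>i\<le>k. of_real (a i) * X ^ (2 * i) * (of_real (b (k - i)) * X ^ (2 * (k - i)))) = (\<Sum>u\<le>k. of_real (a u) * of_real (b (k - u))) * X ^ (2 * k)" for k
    unfolding sum_distrib_right by (rule sum.cong[OF refl])
  ultimately show ?thesis by simp
qed

text \<open>Twice the tangent product plus the cosecant product is pi X / sin(pi X) times (1 -
  cos(pi X)) W + K - W, in which W without cosine cancels. Both products have constant term 0, so
  the series may start at k = 1.\<close>

lemma coeff4p2_sums:
  assumes X: "norm (X::complex) < 1" "X \<noteq> 0"
  shows "(\<lambda>n. coeff4p2 (Suc n) * X ^ (2 * Suc n)) sums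
    (of_real pi * zeta_even_sum X - \<i> * of_real pi * X / sin (of_real pi * X) * (Kfun X - cos (of_real pi * X) * Wfun X))"
proof -
  define t where "t = (\<lambda>k. (\<Sum>u\<le>k. complex_of_real (tan_coeff u) * of_real (wcoeff (k - u))) * X ^ (2 * k))"
  define s where "s = (\<lambda>k. (\<Sum>u\<le>k. complex_of_real (csc_coeff u) * of_real (kcoeff (k - u) - wcoeff (k - u))) * X ^ (2 * k))"
  define T where "T = of_real pi * X / 2 * ((1 - cos (of_real pi * X)) / sin (of_real pi * X)) * Wfun X"
  define S where "S = of_real pi * X / sin (of_real pi * X) * (Kfun X - Wfun X)"
  have kw: "(\<lambda>j. of_real (kcoeff j - wcoeff j) * X ^ (2 * j)) sums (Kfun X - Wfun X)" if "norm X < 1" for X :: complex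
    using sums_diff[OF Kfun_sums[OF that] Wfun_sums[OF that]] by (simp add: left_diff_distrib)
  have "t sums T" unfolding t_def T_def
    by (rule even_Cauchy_product_sums[OF tan_coeff_sums Wfun_sums X])
  moreover have "t 0 = 0" by (simp add: t_def tan_coeff_def)
  ultimately have t: "(\<lambda>n. t (Suc n)) sums T" by (simp add: sums_Suc_iff)
  have "s sums S" unfolding s_def S_def
    by (rule even_Cauchy_product_sums[OF csc_coeff_sums kw X])
  moreover have "s 0 = 0" by (simp add: s_def kcoeff_def wcoeff_def)
  ultimately have s: "(\<lambda>n. s (Suc n)) sums S" by (simp add: sums_Suc_iff)
  have "(\<lambda>n. of_real pi * (of_real (mzv [2 * Suc n]) * X ^ (2 * Suc n)) - 2 * \<i> * t (Suc n) - \<i> * s (Suc n)) sums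
      (of_real pi * zeta_even_sum X - 2 * \<i> * T - \<i> * S)"
    by (intro sums_diff sums_mult zeta_even_sums t s X)
  also have "(\<lambda>n. of_real pi * (of_real (mzv [2 * Suc n]) * X ^ (2 * Suc n)) - 2 * \<i> * t (Suc n) - \<i> * s (Suc n)) =
     (\<lambda>n. coeff4p2 (Suc n) * X ^ (2 * Suc n))"
  proof
    fix n
    have "coeff4p2 (Suc n) * X ^ (2 * Suc n) = of_real (pi * mzv [2 * Suc n]) * X ^ (2 * Suc n) - 2 * \<i> * t (Suc n) - \<i> * s (Suc n)"
      by (subst coeff4p2_eq) (simp, simp only: t_def s_def left_diff_distrib mult.assoc)
    thus "of_real pi * (of_real (mzv [2 * Suc n]) * X ^ (2 * Suc n)) - 2 * \<i> * t (Suc n) - \<i> * s (Suc n) = coeff4p2 (Suc n) * X ^ (2 * Suc n)"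
      by (simp only: of_real_mult mult.assoc)
  qed
  also have "of_real pi * zeta_even_sum X - 2 * \<i> * T - \<i> * S =
     of_real pi * zeta_even_sum X - \<i> * of_real pi * X / sin (of_real pi * X) * (Kfun X - cos (of_real pi * X) * Wfun X)"
    unfolding T_def S_def using sin_pi_nonzero[OF X] by (simp add: field_simps)
  finally show ?thesis .
qed

text \<open>The point X = 0 is a removable singularity of the right-hand side; read literally, with
  division by zero giving 0, that side would be pi/2 there while the series is 0.\<close>

theorem theorem4p2:
  fixes X :: complex
  assumes "norm X < 1" and "X \<noteq> 0"
  shows "(\<lambda>n. coeff4p2 (Suc n) * X ^ (2 * Suc n)) sums
           (of_real (pi / 2) - of_real (pi ^ 2 / 2) * X * cot (of_real pi * X)
            + \<i> * of_real pi * X ^ 2 / sin (of_real pi * X)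
                * integral {0..pi/3} (\<lambda>\<theta>. sin ((of_real \<theta> + of_real pi) * X) * of_real (A_fun \<theta>))
            - 2 * \<i> * of_real pi * X / sin (of_real pi * X)
                * integral {0..pi/3} (\<lambda>\<theta>. sinh (of_real (A_fun \<theta>) * X)
                     * sin ((of_real \<theta> + of_real pi) / 2 * X) * cos ((of_real \<theta> - of_real pi) * X)))
         \<and> (\<forall>k::nat. k \<ge> 1 \<longrightarrow>
              mzv [2 * k] = (-1) ^ (k + 1) * (2 * pi) ^ (2 * k) * bernoulli (2 * k) / (2 * fact (2 * k)))"
proof (intro conjI allI impI mzv_even_bernoulli)
  let ?I = "integral {0..pi/3} (\<lambda>\<theta>. sin ((of_real \<theta> + of_real pi) * X) * of_real (A_fun \<theta>))"
  let ?J = "integral {0..pi/3} (\<lambda>\<theta>. sinh (of_real (A_fun \<theta>) * X)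
                     * sin ((of_real \<theta> + of_real pi) / 2 * X) * cos ((of_real \<theta> - of_real pi) * X))"
  have r: "of_real pi * zeta_even_sum X = of_real (pi / 2) - of_real (pi ^ 2 / 2) * X * cot (of_real pi * X)"
    using assms by (simp add: zeta_even_sum_def field_simps power2_eq_square)
  have "of_real pi * zeta_even_sum X - \<i> * of_real pi * X / sin (of_real pi * X) * (Kfun X - cos (of_real pi * X) * Wfun X) =
    of_real pi * zeta_even_sum X + \<i> * of_real pi * X / sin (of_real pi * X) * (cos (of_real pi * X) * Wfun X - Kfun X)"
    by (simp add: right_diff_distrib)
  also have "\<dots> = of_real (pi / 2) - of_real (pi ^ 2 / 2) * X * cot (of_real pi * X)
     + \<i> * of_real pi * X ^ 2 / sin (of_real pi * X) * ?I - 2 * \<i> * of_real pi * X / sin (of_real pi * X) * ?J"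
    unfolding integral_side[OF assms, symmetric] r by (simp add: right_diff_distrib power2_eq_square mult_ac)
  finally show "(\<lambda>n. coeff4p2 (Suc n) * X ^ (2 * Suc n)) sums
           (of_real (pi / 2) - of_real (pi ^ 2 / 2) * X * cot (of_real pi * X)
            + \<i> * of_real pi * X ^ 2 / sin (of_real pi * X) * ?I
            - 2 * \<i> * of_real pi * X / sin (of_real pi * X) * ?J)"
    using coeff4p2_sums[OF assms] by simp
qed

end
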